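(* Let $M$ be an $n$-dimensional smooth manifold with an affine connection $\nabla$, and let $\omega$ be the corresponding linear connection (principal connection on the bundle $L(M)$ of linear frames). The map $Z:TM\to TTM$ defined by $$Z(v)=T_u\Phi_\xi\big(B(\xi)_u\big),\qquad v\in TM,$$ where $u\in L_{\tau_M(v)}(M)$ and $\xi\in\mathbb R^n$ are such that $u\xi=v$, is a second-order vector field on $TM$. In terms of the canonical tangent bundle coordinates $(x^i,v^i)$ it is given by $$Z=v^i\frac{\partial}{\partial x^i}-\Gamma^i_{jk}v^jv^k\frac{\partial}{\partial v^i}.$$
   Context: $\pi_M:L(M)\to M$ is the principal $GL(n;\mathbb R)$-bundle of linear frames; a frame $u\in L_x(M)$ is regarded as a linear isomorphism $u:\mathbb R^n\to T_xM$. $\tau_M:TM\to M$ is the tangent bundle projection. For fixed $\xi\in\mathbb R^n$, the association map $\Phi_\xi:L(M)\to TM$ is $\Phi_\xi(u)=u\xi$. The standard horizontal vector field $B(\xi)$ on $L(M)$ is defined by: $B(\xi)_u$ is the unique $\omega$-horizontal vector at $u$ with $T_u\pi_M(B(\xi)_u)=u\xi$. The correspondence between $\omega$ and $\nabla$ is the standard one: $\nabla_XY(x)=u\big((\mathscr L_{X^h}f_Y)(u)\big)$ for $\pi_M(u)=x$, where $X^h$ is the horizontal lift of $X$ to $L(M)$ and $f_Y:L(M)\to\mathbb R^n$, $f_Y(u)=u^{-1}(Y(\pi_M(u)))$. $\Gamma^i_{jk}$ are the Christoffel symbols, $\nabla_{\partial_j}\partial_k=\Gamma^i_{jk}\partial_i$;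 repeated indices are summed. A second-order vector field on $TM$ is a vector field $S$ on $TM$ with $T\tau_M(S(v))=v$ for all $v\in TM$. *)

theory Defs
  imports "HOL-Analysis.Analysis"
begin

subsection \<open>Smooth functions between normed spaces\<close>

text \<open>Only used on open sets. All iterated directional derivatives exist and are differentiable functions,
  in particular continuous, so in finite dimension this is the usual class of
  infinitely differentiable functions.\<close>

primrec times_differentiable_on ::
    "nat \<Rightarrow> ('a::real_normed_vector) set \<Rightarrow> ('a \<Rightarrow> 'b::real_normed_vector) \<Rightarrow> bool" where
  "times_differentiable_on 0 S f \<longleftrightarrow> continuous_on S f"
| "times_differentiable_on (Suc k) S f \<longleftrightarrow>
     (\<forall>x\<in>S. f differentiable (at x)) \<and>
     (\<forall>e. times_differentiable_on k S (\<lambda>x. frechet_derivative f (at x) e))"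

definition smooth_on :: "('a::real_normed_vector) set \<Rightarrow> ('a \<Rightarrow> 'b::real_normed_vector) \<Rightarrow> bool" where
  "smooth_on S f \<longleftrightarrow> (\<forall>k. times_differentiable_on k S f)"


subsection \<open>Manifolds given by an atlas\<close>

text \<open>A chart is a domain together with a coordinate map; the values of the map outside the domain
  are irrelevant. A manifold is given by an atlas, which need not be maximal; the maximal atlas of a
  smooth structure is a particular case. The underlying set is the union of the chart domains, so
  that the tangent bundle and the frame bundle are manifolds in the same sense, living on subsets
  of a type.\<close>

type_synonym ('m, 'e) chart = "'m set \<times> ('m \<Rightarrow> 'e)"
type_synonym ('m, 'e) atlas = "('m, 'e) chart set"

definition manifold_carrier :: "('m, 'e) atlas \<Rightarrow> 'm set" where
  "manifold_carrier A = (\<Union>c\<in>A. fst c)"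

definition chart_inv :: "('m, 'e) chart \<Rightarrow> 'e \<Rightarrow> 'm" where
  "chart_inv c = inv_into (fst c) (snd c)"

definition charts_at :: "('m, 'e) atlas \<Rightarrow> 'm \<Rightarrow> ('m, 'e) chart set" where
  "charts_at A p = {c \<in> A. p \<in> fst c}"

definition manifold_topology :: "('m, 'e::topological_space) atlas \<Rightarrow> 'm topology" where
  "manifold_topology A = topology_generated_by {fst c \<inter> snd c -` S | c S. c \<in> A \<and> open S}"

definition smooth_manifold :: "('m, 'e::euclidean_space) atlas \<Rightarrow> bool" where
  "smooth_manifold A \<longleftrightarrow>
     (\<forall>c\<in>A. inj_on (snd c) (fst c) \<and> open (snd c ` fst c)) \<and>
     (\<forall>c\<in>A. \<forall>d\<in>A. open (snd c ` (fst c \<inter> fst d)) \<and>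
        smooth_on (snd c ` (fst c \<inter> fst d)) (snd d \<circ> chart_inv c)) \<and>
     Hausdorff_space (manifold_topology A) \<and> second_countable (manifold_topology A)"

definition smooth_function :: "('m, 'e::real_normed_vector) atlas \<Rightarrow> ('m \<Rightarrow> real) \<Rightarrow> bool" where
  "smooth_function A f \<longleftrightarrow> (\<forall>c\<in>A. smooth_on (snd c ` fst c) (f \<circ> chart_inv c))"


subsection \<open>Tangent vectors, tangent maps and vector fields\<close>

text \<open>A tangent vector is a pair of a base point \<open>p\<close> and the family of its coordinate
  representations in all charts at \<open>p\<close>, related by the derivatives of the chart transitions
  (equivalently, a class of triples chart, point, coordinate vector). The family is set to 0 at
  charts whose domain does not contain \<open>p\<close>.\<close>

type_synonym ('m, 'e) tvec = "'m \<times> (('m, 'e) chart \<Rightarrow> 'e)"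

definition tangent_space ::
    "('m, 'e::real_normed_vector) atlas \<Rightarrow> 'm \<Rightarrow> ('m, 'e) tvec set" where
  "tangent_space A p = {(p, V) | V.
     (\<forall>c. c \<notin> charts_at A p \<longrightarrow> V c = 0) \<and>
     (\<forall>c\<in>charts_at A p. \<forall>d\<in>charts_at A p.
        V d = frechet_derivative (snd d \<circ> chart_inv c) (at (snd c p)) (V c))}"

definition tangent_bundle :: "('m, 'e::real_normed_vector) atlas \<Rightarrow> ('m, 'e) tvec set" where
  "tangent_bundle A = (\<Union>p\<in>manifold_carrier A. tangent_space A p)"

text \<open>The vector space operations of a tangent space; the sum is only meant for vectors with the
  same base point.\<close>

definition tv_add ::
    "('m, 'e::real_normed_vector) tvec \<Rightarrow> ('m, 'e) tvec \<Rightarrow> ('m, 'e) tvec" where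
  "tv_add v w = (fst v, \<lambda>c. snd v c + snd w c)"

definition tv_scale :: "real \<Rightarrow> ('m, 'e::real_normed_vector) tvec \<Rightarrow> ('m, 'e) tvec" where
  "tv_scale a v = (fst v, \<lambda>c. a *\<^sub>R snd v c)"

text \<open>The tangent vector at \<open>p\<close> with coordinate vector \<open>e\<close> in the chart \<open>c\<close>, that is
  the sum of the \<open>e\<^sup>i \<partial>/\<partial>y\<^sup>i\<close> at \<open>p\<close>, where the \<open>y\<^sup>i\<close> are the coordinate
  functions of \<open>c\<close>.\<close>

definition coord_vec ::
    "('m, 'e::real_normed_vector) atlas \<Rightarrow> ('m, 'e) chart \<Rightarrow> 'm \<Rightarrow> 'e \<Rightarrow> ('m, 'e) tvec" where
  "coord_vec A c p e = (p, \<lambda>d. if d \<in> charts_at A p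
     then frechet_derivative (snd d \<circ> chart_inv c) (at (snd c p)) e else 0)"

text \<open>In the next two definitions the choice of the chart at the base point is immaterial for maps
  that are differentiable there, by the chain rule.\<close>

definition tangent_map ::
    "('m, 'e::real_normed_vector) atlas \<Rightarrow> ('k, 'f::real_normed_vector) atlas \<Rightarrow>
     ('m \<Rightarrow> 'k) \<Rightarrow> ('m, 'e) tvec \<Rightarrow> ('k, 'f) tvec" where
  "tangent_map A B f w =
     (let c = (SOME c. c \<in> charts_at A (fst w)) in
      (f (fst w), \<lambda>d. if d \<in> charts_at B (f (fst w))
         then frechet_derivative (snd d \<circ> f \<circ> chart_inv c) (at (snd c (fst w))) (snd w c) else 0))"

definition derivative_along ::
    "('m, 'e::real_normed_vector) atlas \<Rightarrow> ('m, 'e) tvec \<Rightarrow>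
     ('m \<Rightarrow> 'b::real_normed_vector) \<Rightarrow> 'b" where
  "derivative_along A w f =
     (let c = (SOME c. c \<in> charts_at A (fst w)) in
      frechet_derivative (f \<circ> chart_inv c) (at (snd c (fst w))) (snd w c))"

text \<open>Smooth vector fields; they are extensional, so that fields equal on the manifold are equal.\<close>

definition vector_fields ::
    "('m, 'e::real_normed_vector) atlas \<Rightarrow> ('m \<Rightarrow> ('m, 'e) tvec) set" where
  "vector_fields A = {X \<in> \<Pi>\<^sub>E p\<in>manifold_carrier A. tangent_space A p.
     \<forall>c\<in>A. smooth_on (snd c ` fst c) (\<lambda>y. snd (X (chart_inv c y)) c)}"

definition vf_add ::
    "('m, 'e::real_normed_vector) atlas \<Rightarrow> ('m \<Rightarrow> ('m, 'e) tvec) \<Rightarrow> ('m \<Rightarrow> ('m, 'e) tvec) \<Rightarrow>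
     'm \<Rightarrow> ('m, 'e) tvec" where
  "vf_add A X Y = (\<lambda>p\<in>manifold_carrier A. tv_add (X p) (Y p))"

definition vf_scale ::
    "('m, 'e::real_normed_vector) atlas \<Rightarrow> ('m \<Rightarrow> real) \<Rightarrow> ('m \<Rightarrow> ('m, 'e) tvec) \<Rightarrow>
     'm \<Rightarrow> ('m, 'e) tvec" where
  "vf_scale A f X = (\<lambda>p\<in>manifold_carrier A. tv_scale (f p) (X p))"


subsection \<open>The tangent bundle as a manifold; second-order vector fields\<close>

text \<open>The canonical coordinates \<open>(x, v)\<close> on the tangent bundle; its projection is \<open>fst\<close>.\<close>

definition tangent_chart ::
    "('m, 'e::real_normed_vector) atlas \<Rightarrow> ('m, 'e) chart \<Rightarrow> (('m, 'e) tvec, 'e \<times> 'e) chart" where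
  "tangent_chart A c =
     ({v \<in> tangent_bundle A. fst v \<in> fst c}, \<lambda>v. (snd c (fst v), snd v c))"

definition tangent_atlas ::
    "('m, 'e::real_normed_vector) atlas \<Rightarrow> (('m, 'e) tvec, 'e \<times> 'e) atlas" where
  "tangent_atlas A = tangent_chart A ` A"

definition second_order_vector_field ::
    "('m, 'e::real_normed_vector) atlas \<Rightarrow>
     (('m, 'e) tvec \<Rightarrow> (('m, 'e) tvec, 'e \<times> 'e) tvec) \<Rightarrow> bool" where
  "second_order_vector_field A S \<longleftrightarrow> S \<in> vector_fields (tangent_atlas A) \<and>
     (\<forall>v\<in>tangent_bundle A. tangent_map (tangent_atlas A) A fst (S v) = v)"


subsection \<open>Affine connections and Christoffel symbols\<close>

definition affine_connection ::
    "('m, 'e::real_normed_vector) atlas \<Rightarrow>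
     (('m \<Rightarrow> ('m, 'e) tvec) \<Rightarrow> ('m \<Rightarrow> ('m, 'e) tvec) \<Rightarrow> 'm \<Rightarrow> ('m, 'e) tvec) \<Rightarrow> bool" where
  "affine_connection A nabla \<longleftrightarrow>
     (\<forall>X\<in>vector_fields A. \<forall>Y\<in>vector_fields A.
        nabla X Y \<in> vector_fields A \<and>
        (\<forall>X'\<in>vector_fields A. nabla (vf_add A X X') Y = vf_add A (nabla X Y) (nabla X' Y)) \<and>
        (\<forall>Y'\<in>vector_fields A. nabla X (vf_add A Y Y') = vf_add A (nabla X Y) (nabla X Y')) \<and>
        (\<forall>f. smooth_function A f \<longrightarrow>
           nabla (vf_scale A f X) Y = vf_scale A f (nabla X Y) \<and>
           nabla X (vf_scale A f Y) =
             vf_add A (vf_scale A (\<lambda>p. derivative_along A (X p) f) Y)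
                      (vf_scale A f (nabla X Y))))"

text \<open>The connection induced on the open set \<open>W\<close>: the vector fields \<open>X\<close>, \<open>Y\<close> on \<open>W\<close> are
  replaced by global fields that agree with them near \<open>p\<close>; the value does not depend on
  these.\<close>

definition local_nabla ::
    "('m, 'e::real_normed_vector) atlas \<Rightarrow>
     (('m \<Rightarrow> ('m, 'e) tvec) \<Rightarrow> ('m \<Rightarrow> ('m, 'e) tvec) \<Rightarrow> 'm \<Rightarrow> ('m, 'e) tvec) \<Rightarrow>
     'm set \<Rightarrow> ('m \<Rightarrow> ('m, 'e) tvec) \<Rightarrow> ('m \<Rightarrow> ('m, 'e) tvec) \<Rightarrow> 'm \<Rightarrow> ('m, 'e) tvec" where
  "local_nabla A nabla W X Y p = (THE w. \<exists>X'\<in>vector_fields A. \<exists>Y'\<in>vector_fields A.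
     (\<exists>V. openin (manifold_topology A) V \<and> p \<in> V \<and> V \<subseteq> W \<and>
        (\<forall>q\<in>V. X' q = X q \<and> Y' q = Y q)) \<and>
     w = nabla X' Y' p)"

definition coord_field ::
    "('m, real^'n) atlas \<Rightarrow> ('m, real^'n) chart \<Rightarrow> 'n \<Rightarrow> 'm \<Rightarrow> ('m, real^'n) tvec" where
  "coord_field A c j q = coord_vec A c q (axis j 1)"

definition christoffel ::
    "('m, real^'n) atlas \<Rightarrow>
     (('m \<Rightarrow> ('m, real^'n) tvec) \<Rightarrow> ('m \<Rightarrow> ('m, real^'n) tvec) \<Rightarrow> 'm \<Rightarrow> ('m, real^'n) tvec) \<Rightarrow>
     ('m, real^'n) chart \<Rightarrow> 'm \<Rightarrow> 'n \<Rightarrow> 'n \<Rightarrow> 'n \<Rightarrow> real" where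
  "christoffel A nabla c p i j k =
     snd (local_nabla A nabla (fst c) (coord_field A c j) (coord_field A c k) p) c $ i"


subsection \<open>The bundle of linear frames\<close>

text \<open>A frame is a function into the tangent bundle, so that the tangent vector \<open>u\<xi>\<close> is
  \<open>u \<xi>\<close>. Linearity is expressed chart by chart because the vector space operations on tangent
  vectors are those of the coordinate representations.\<close>

type_synonym ('m, 'n) frame = "real^'n \<Rightarrow> ('m, real^'n) tvec"

definition frames_at :: "('m, real^'n) atlas \<Rightarrow> 'm \<Rightarrow> ('m, 'n) frame set" where
  "frames_at A p = {u. bij_betw u UNIV (tangent_space A p) \<and> (\<forall>c. linear (\<lambda>\<xi>. snd (u \<xi>) c))}"

definition frame_bundle :: "('m, real^'n) atlas \<Rightarrow> ('m, 'n) frame set" where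
  "frame_bundle A = (\<Union>p\<in>manifold_carrier A. frames_at A p)"

definition frame_proj :: "('m, 'n::finite) frame \<Rightarrow> 'm" where
  "frame_proj u = fst (u 0)"

definition frame_act :: "('m, 'n::finite) frame \<Rightarrow> real^'n^'n \<Rightarrow> ('m, 'n) frame" where
  "frame_act u g = (\<lambda>\<xi>. u (g *v \<xi>))"

definition frame_chart ::
    "('m, real^'n) atlas \<Rightarrow> ('m, real^'n) chart \<Rightarrow>
     (('m, 'n) frame, (real^'n) \<times> (real^'n^'n)) chart" where
  "frame_chart A c =
     ({u \<in> frame_bundle A. frame_proj u \<in> fst c},
      \<lambda>u. (snd c (frame_proj u), matrix (\<lambda>\<xi>. snd (u \<xi>) c)))"

definition frame_atlas ::
    "('m, real^'n) atlas \<Rightarrow> (('m, 'n) frame, (real^'n) \<times> (real^'n^'n)) atlas" where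
  "frame_atlas A = frame_chart A ` A"

type_synonym ('m, 'n) frame_tvec = "(('m, 'n) frame, (real^'n) \<times> (real^'n^'n)) tvec"

text \<open>The value at \<open>u\<close> of the fundamental vector field of a matrix \<open>a\<close>: the image of \<open>a\<close>
  under the derivative at the identity of \<open>g \<mapsto> u g\<close>.\<close>

definition fundamental_vector ::
    "('m, real^'n) atlas \<Rightarrow> real^'n^'n \<Rightarrow> ('m, 'n) frame \<Rightarrow> ('m, 'n) frame_tvec" where
  "fundamental_vector A a u = (u, \<lambda>d. if d \<in> charts_at (frame_atlas A) u
     then frechet_derivative (\<lambda>g. snd d (frame_act u g)) (at (mat 1)) a else 0)"


subsection \<open>Linear connections\<close>

text \<open>Smooth one-forms on the frame bundle with values in the matrices that reproduce the generators
  of the fundamental fields and are equivariant.\<close>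

definition linear_connection ::
    "('m, real^'n) atlas \<Rightarrow> (('m, 'n) frame_tvec \<Rightarrow> real^'n^'n) \<Rightarrow> bool" where
  "linear_connection A \<omega> \<longleftrightarrow>
     (\<forall>u\<in>frame_bundle A. \<forall>w\<in>tangent_space (frame_atlas A) u.
        (\<forall>w'\<in>tangent_space (frame_atlas A) u. \<omega> (tv_add w w') = \<omega> w + \<omega> w') \<and>
        (\<forall>a. \<omega> (tv_scale a w) = a *\<^sub>R \<omega> w)) \<and>
     (\<forall>c\<in>frame_atlas A. \<forall>e.
        smooth_on (snd c ` fst c) (\<lambda>y. \<omega> (coord_vec (frame_atlas A) c (chart_inv c y) e))) \<and>
     (\<forall>u\<in>frame_bundle A. \<forall>a. \<omega> (fundamental_vector A a u) = a) \<and>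
     (\<forall>u\<in>frame_bundle A. \<forall>w\<in>tangent_space (frame_atlas A) u. \<forall>g. invertible g \<longrightarrow>
        \<omega> (tangent_map (frame_atlas A) (frame_atlas A) (\<lambda>u. frame_act u g) w) =
          matrix_inv g ** \<omega> w ** g)"

definition horizontal_vector ::
    "('m, real^'n) atlas \<Rightarrow> (('m, 'n) frame_tvec \<Rightarrow> real^'n^'n) \<Rightarrow> ('m, 'n) frame \<Rightarrow>
     ('m, real^'n) tvec \<Rightarrow> ('m, 'n) frame_tvec" where
  "horizontal_vector A \<omega> u v = (THE w. w \<in> tangent_space (frame_atlas A) u \<and> \<omega> w = 0 \<and>
     tangent_map (frame_atlas A) A frame_proj w = v)"

definition horizontal_lift ::
    "('m, real^'n) atlas \<Rightarrow> (('m, 'n) frame_tvec \<Rightarrow> real^'n^'n) \<Rightarrow>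
     ('m \<Rightarrow> ('m, real^'n) tvec) \<Rightarrow> ('m, 'n) frame \<Rightarrow> ('m, 'n) frame_tvec" where
  "horizontal_lift A \<omega> X u = horizontal_vector A \<omega> u (X (frame_proj u))"

definition standard_horizontal ::
    "('m, real^'n) atlas \<Rightarrow> (('m, 'n) frame_tvec \<Rightarrow> real^'n^'n) \<Rightarrow>
     real^'n \<Rightarrow> ('m, 'n) frame \<Rightarrow> ('m, 'n) frame_tvec" where
  "standard_horizontal A \<omega> \<xi> u = horizontal_vector A \<omega> u (u \<xi>)"

definition frame_function ::
    "('m \<Rightarrow> ('m, real^'n) tvec) \<Rightarrow> ('m, 'n) frame \<Rightarrow> real^'n" where
  "frame_function Y u = inv u (Y (frame_proj u))"

definition corresponding_connections ::
    "('m, real^'n) atlas \<Rightarrow>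
     (('m \<Rightarrow> ('m, real^'n) tvec) \<Rightarrow> ('m \<Rightarrow> ('m, real^'n) tvec) \<Rightarrow> 'm \<Rightarrow> ('m, real^'n) tvec) \<Rightarrow>
     (('m, 'n) frame_tvec \<Rightarrow> real^'n^'n) \<Rightarrow> bool" where
  "corresponding_connections A nabla \<omega> \<longleftrightarrow>
     (\<forall>X\<in>vector_fields A. \<forall>Y\<in>vector_fields A. \<forall>u\<in>frame_bundle A.
        nabla X Y (frame_proj u) =
          u (derivative_along (frame_atlas A) (horizontal_lift A \<omega> X u) (frame_function Y)))"


subsection \<open>The vector field determined by a linear connection\<close>

definition association_map :: "real^'n \<Rightarrow> ('m, 'n) frame \<Rightarrow> ('m, real^'n) tvec" where
  "association_map \<xi> u = u \<xi>"

text \<open>The possible values of \<open>Z(v)\<close>, over all \<open>u\<close> and \<open>\<xi>\<close> with \<open>u\<xi> = v\<close>. That there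
  is exactly one is part of the theorem.\<close>

definition is_Z_value ::
    "('m, real^'n) atlas \<Rightarrow> (('m, 'n) frame_tvec \<Rightarrow> real^'n^'n) \<Rightarrow> ('m, real^'n) tvec \<Rightarrow>
     (('m, real^'n) tvec, (real^'n) \<times> (real^'n)) tvec \<Rightarrow> bool" where
  "is_Z_value A \<omega> v w \<longleftrightarrow> (\<exists>u\<in>frames_at A (fst v). \<exists>\<xi>. u \<xi> = v \<and>
     w = tangent_map (frame_atlas A) (tangent_atlas A) (association_map \<xi>)
           (standard_horizontal A \<omega> \<xi> u))"

definition Z_field ::
    "('m, real^'n) atlas \<Rightarrow> (('m, 'n) frame_tvec \<Rightarrow> real^'n^'n) \<Rightarrow>
     ('m, real^'n) tvec \<Rightarrow> (('m, real^'n) tvec, (real^'n) \<times> (real^'n)) tvec" where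
  "Z_field A \<omega> = (\<lambda>v\<in>tangent_bundle A. THE w. is_Z_value A \<omega> v w)"

end

theory Submission
  imports Defs
begin

text \<open>In a chart, let \<open>\<theta>\<close> be the pullback of \<open>\<omega>\<close> along the coordinate frame. The vector at the
  coordinate frame over \<open>v\<close> with matrix part \<open>- \<theta>(v)\<close> is horizontal, and by equivariance the horizontal
  vector over \<open>v\<close> at the frame with matrix \<open>m\<close> has matrix part \<open>- \<theta>(v) m\<close>. As \<open>\<Phi>\<^sub>\<xi>\<close> multiplies the
  matrix by \<open>\<xi>\<close>, and \<open>m \<xi> = v\<close>, the value of \<open>Z\<close> is \<open>(v, - \<theta>(v) v)\<close> whatever \<open>u\<close> and \<open>\<xi>\<close> are. The
  frame function of \<open>\<partial>\<^sub>k\<close> is \<open>m\<^sup>-\<^sup>1 e\<^sub>k\<close>, and differentiating it along the horizontal lift of \<open>\<partial>\<^sub>j\<close>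
  at the coordinate frame gives \<open>\<theta>(e\<^sub>j) e\<^sub>k\<close>, so the entries of \<open>\<theta>(e\<^sub>j)\<close> are the Christoffel symbols.
  Since the connection acts on global fields only, the coordinate fields are first extended with bump
  functions.\<close>

subsection \<open>Smooth functions\<close>

text \<open>The definitions are full of choices: \<open>tangent_map\<close> and
  \<open>derivative_along\<close> pick a chart, \<open>frechet_derivative\<close> is itself a
  choice, and horizontal vectors, \<open>local_nabla\<close> and the values of
  \<open>Z_field\<close> are definite descriptions. The work lies in evaluating each of them in one
  convenient chart. In the charts induced by \<open>c\<close>, the frame projection, the right
  action and the association map are linear, so they coincide with their derivatives there. The one
  nonlinear ingredient is matrix inversion, which enters through the frame function; since the frame
  over a point may be chosen freely, its derivative is wanted at the identity matrix alone.
  Smoothness of \<open>Z_field\<close> is inherited from that of \<open>\<omega>\<close> in the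
  frame charts; the Christoffel symbols come in only at the end, once they are identified with
  entries of the local form.\<close>

lemma frechet_derivative_eq: "(f has_derivative f') (at x) \<Longrightarrow> frechet_derivative f (at x) = f'"
  by (metis frechet_derivative_at)

text \<open>Derivatives at points of \<open>S\<close> depend on a neighbourhood, so openness is
  essential. The rule allows a function to be replaced by a formula that is valid merely inside a
  chart.\<close>

lemma times_differentiable_on_cong:
  assumes "open S" "\<And>x. x \<in> S \<Longrightarrow> f x = g x" "times_differentiable_on k S f"
  shows "times_differentiable_on k S g"
  using assms(2,3)
proof (induction k arbitrary: f g)
  case 0
  then show ?case by (simp cong: continuous_on_cong)
next
  case (Suc k)
  have D: "(g has_derivative frechet_derivative f (at x)) (at x)" if "x \<in> S" for x
  proof (rule has_derivative_transform_within_open[OF _ assms(1) that Suc.prems(1)])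
    show "(f has_derivative frechet_derivative f (at x)) (at x)"
      using Suc.prems(2) that by (simp add: frechet_derivative_works)
  qed
  have "times_differentiable_on k S (\<lambda>x. frechet_derivative g (at x) e)" for e
    by (rule Suc.IH[of "\<lambda>x. frechet_derivative f (at x) e"])
      (use Suc.prems(2) in \<open>auto simp: frechet_derivative_eq[OF D]\<close>)
  with D show ?case by (auto simp: differentiable_def)
qed

text \<open>Trades the chosen \<open>frechet_derivative\<close> for an explicit derivative, so that
  the closure properties below become a differentiation rule plus an induction hypothesis.\<close>

lemma times_differentiable_onI:
  assumes "open S" "\<And>x. x \<in> S \<Longrightarrow> (f has_derivative f' x) (at x)"
    and "\<And>e. times_differentiable_on k S (\<lambda>x. f' x e)"
  shows "times_differentiable_on (Suc k) S f"
proof -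
  have "times_differentiable_on k S (\<lambda>x. frechet_derivative f (at x) e)" for e
    by (rule times_differentiable_on_cong[OF assms(1) _ assms(3)[of e]])
      (simp add: frechet_derivative_eq[OF assms(2)])
  with assms(2) show ?thesis by (auto simp: differentiable_def)
qed

lemma times_differentiable_on_Suc_has_derivative:
  assumes "times_differentiable_on (Suc k) S f" "x \<in> S"
  shows "(f has_derivative frechet_derivative f (at x)) (at x)"
  using assms by (simp add: frechet_derivative_works)

lemma times_differentiable_on_continuous:
  "times_differentiable_on k S f \<Longrightarrow> continuous_on S f"
  by (cases k) (auto intro!: continuous_at_imp_continuous_on differentiable_imp_continuous_within)

lemma times_differentiable_on_SucD:
  "times_differentiable_on (Suc k) S f \<Longrightarrow> times_differentiable_on k S f"
proof (induction k arbitrary: f)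
  case 0
  then show ?case by (metis times_differentiable_on_continuous times_differentiable_on.simps(1))
next
  case (Suc k)
  then show ?case by (metis times_differentiable_on.simps(2))
qed

lemma times_differentiable_on_subset:
  "times_differentiable_on k S f \<Longrightarrow> T \<subseteq> S \<Longrightarrow> times_differentiable_on k T f"
  by (induction k arbitrary: f) (auto intro: continuous_on_subset)

text \<open>Needed for vector fields patched together from two formulas, each smooth for its own
  reason on its own open set.\<close>

lemma times_differentiable_on_locally:
  assumes "\<And>x. x \<in> S \<Longrightarrow> \<exists>U. open U \<and> x \<in> U \<and> times_differentiable_on k U f"
  shows "times_differentiable_on k S f"
  using assms
proof (induction k arbitrary: f)
  case 0
  then show ?case
    by (auto intro!: continuous_at_imp_continuous_on dest!: 0 simp: continuous_on_eq_continuous_at)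
next
  case (Suc k)
  have "times_differentiable_on k S (\<lambda>x. frechet_derivative f (at x) e)" for e
    by (rule Suc.IH) (use Suc.prems in fastforce)
  with Suc.prems show ?case by fastforce
qed

lemma times_differentiable_on_const:
  "open S \<Longrightarrow> times_differentiable_on k S (\<lambda>x. c)"
proof (induction k arbitrary: c)
  case (Suc k)
  then show ?case by (intro times_differentiable_onI[where f' = "\<lambda>x e. 0"]) auto
qed auto

lemma times_differentiable_on_linear:
  assumes "bounded_linear f" "open S"
  shows "times_differentiable_on k S f"
proof (cases k)
  case 0
  then show ?thesis using assms by (simp add: linear_continuous_on)
next
  case (Suc k)
  then show ?thesis
    using times_differentiable_onI[of S f "\<lambda>x. f" k] assms
    by (auto intro: bounded_linear_imp_has_derivative times_differentiable_on_const)
qed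

lemma times_differentiable_on_add:
  assumes "open S" "times_differentiable_on k S f" "times_differentiable_on k S g"
  shows "times_differentiable_on k S (\<lambda>x. f x + g x)"
  using assms(2,3)
proof (induction k arbitrary: f g)
  case 0
  then show ?case by (auto intro: continuous_on_add)
next
  case (Suc k)
  show ?case
    by (rule times_differentiable_onI[OF assms(1) has_derivative_add])
      (use Suc in \<open>auto simp: frechet_derivative_works\<close>)
qed

lemma times_differentiable_on_sum:
  assumes "open S" "\<And>i. i \<in> I \<Longrightarrow> times_differentiable_on k S (f i)"
  shows "times_differentiable_on k S (\<lambda>x. \<Sum>i\<in>I. f i x)"
  using assms
  by (induction I rule: infinite_finite_induct)
    (auto intro: times_differentiable_on_const times_differentiable_on_add)

lemma (in bounded_bilinear) times_differentiable_on:
  assumes "open S" "times_differentiable_on k S f" "times_differentiable_on k S g"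
  shows "times_differentiable_on k S (\<lambda>x. prod (f x) (g x))"
  using assms(2,3)
proof (induction k arbitrary: f g)
  case 0
  then show ?case by (auto intro: continuous_on)
next
  case (Suc k)
  \<comment> \<open>The Leibniz rule leaves one factor undifferentiated in each summand; that factor
    must be available at order \<open>k\<close> as well.\<close>
  note D = Suc.prems[THEN times_differentiable_on_SucD]
  show ?case
    by (rule times_differentiable_onI[OF assms(1) FDERIV])
      (use Suc D in \<open>auto simp: frechet_derivative_works intro!: times_differentiable_on_add assms(1)\<close>)
qed

lemma times_differentiable_on_Pair:
  assumes "open S" "times_differentiable_on k S f" "times_differentiable_on k S g"
  shows "times_differentiable_on k S (\<lambda>x. (f x, g x))"
  using assms(2,3)
proof (induction k arbitrary: f g)
  case 0
  then show ?case by (auto intro: continuous_on_Pair)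
next
  case (Suc k)
  show ?case
    by (rule times_differentiable_onI[OF assms(1) has_derivative_Pair])
      (use Suc in \<open>auto simp: frechet_derivative_works\<close>)
qed

lemma linear_eq_sum_Basis:
  fixes f :: "'a::euclidean_space \<Rightarrow> 'b::real_vector"
  assumes "linear f"
  shows "f x = (\<Sum>b\<in>Basis. (x \<bullet> b) *\<^sub>R f b)"
proof -
  have "f x = f (\<Sum>b\<in>Basis. (x \<bullet> b) *\<^sub>R b)"
    by (simp add: euclidean_representation)
  then show ?thesis by (simp add: linear_sum[OF assms] linear_scale[OF assms])
qed

lemma times_differentiable_on_compose:
  fixes f :: "'a::real_normed_vector \<Rightarrow> 'b::euclidean_space"
  assumes "open S" "open T" "f ` S \<subseteq> T"
    and "times_differentiable_on k S f" "times_differentiable_on k T g"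
  shows "times_differentiable_on k S (\<lambda>x. g (f x))"
  using assms(4,5)
proof (induction k arbitrary: g)
  case 0
  then show ?case using assms(3) continuous_on_compose2 by auto
next
  case (Suc k)
  show ?case
  proof (rule times_differentiable_onI[OF assms(1),
        where f' = "\<lambda>x e. frechet_derivative g (at (f x)) (frechet_derivative f (at x) e)"])
    fix x assume x: "x \<in> S"
    with Suc.prems assms(3) have *: "g differentiable (at (f x))" "f differentiable (at x)" by auto
    show "((\<lambda>x. g (f x)) has_derivative
        (\<lambda>e. frechet_derivative g (at (f x)) (frechet_derivative f (at x) e))) (at x)"
      using diff_chain_at[OF *(2,1)[unfolded frechet_derivative_works]] by (simp add: o_def)
  next
    fix e
    have 1: "times_differentiable_on k S (\<lambda>x. frechet_derivative g (at (f x)) b)" for b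
      using Suc.IH[of "\<lambda>y. frechet_derivative g (at y) b"] Suc.prems
        times_differentiable_on_SucD by auto
    have 2: "times_differentiable_on k S (\<lambda>x. frechet_derivative f (at x) e \<bullet> b)" for b
      using Suc.prems assms(1)
      by (auto intro!: bounded_bilinear.times_differentiable_on[OF bounded_bilinear_inner]
          times_differentiable_on_const)
    \<comment> \<open>The direction in which \<open>g\<close> is differentiated varies with
      \<open>x\<close>, whereas the definition controls fixed directions only. Expanding the
      direction in a basis of the middle space separates the two.\<close>
    have "times_differentiable_on k S (\<lambda>x. \<Sum>b\<in>Basis. (frechet_derivative f (at x) e \<bullet> b) *\<^sub>R
        frechet_derivative g (at (f x)) b)"
      by (intro times_differentiable_on_sum
          bounded_bilinear.times_differentiable_on[OF bounded_bilinear_scaleR] 1 2 assms(1))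
    then show "times_differentiable_on k S
        (\<lambda>x. frechet_derivative g (at (f x)) (frechet_derivative f (at x) e))"
    proof (rule times_differentiable_on_cong[OF assms(1), rotated])
      fix x assume "x \<in> S"
      then have "linear (frechet_derivative g (at (f x)))"
        using Suc.prems assms(3) by (intro linear_frechet_derivative) auto
      from linear_eq_sum_Basis[OF this]
      show "(\<Sum>b\<in>Basis. (frechet_derivative f (at x) e \<bullet> b) *\<^sub>R frechet_derivative g (at (f x)) b)
          = frechet_derivative g (at (f x)) (frechet_derivative f (at x) e)" by (rule sym)
    qed
  qed
qed

lemma times_differentiable_on_inverse:
  "times_differentiable_on k (- {0}) (inverse :: real \<Rightarrow> real)"
proof (induction k)
  case 0
  then show ?case by (auto intro!: continuous_intros)
next
  case (Suc k)
  have o: "open (- {0::real})" by auto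
  \<comment> \<open>The derivative is a polynomial in \<open>inverse\<close> itself, so the
    induction closes without further functions.\<close>
  have "times_differentiable_on k (- {0::real}) (\<lambda>x. (- e) * (inverse x * inverse x))" for e
    by (intro bounded_bilinear.times_differentiable_on[OF bounded_bilinear_mult]
        times_differentiable_on_const Suc o)
  then have "times_differentiable_on k (- {0::real}) (\<lambda>x. - (inverse x * e * inverse x))" for e
    by (simp add: mult_ac)
  then show ?case
    by (intro times_differentiable_onI[OF o has_derivative_inverse']) auto
qed

section \<open>Closure properties of infinitely differentiable functions\<close>

lemma smooth_on_cong:
  "open S \<Longrightarrow> (\<And>x. x \<in> S \<Longrightarrow> f x = g x) \<Longrightarrow> smooth_on S f \<Longrightarrow> smooth_on S g"
  unfolding smooth_on_def by (blast intro: times_differentiable_on_cong)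

lemma smooth_on_subset: "smooth_on S f \<Longrightarrow> T \<subseteq> S \<Longrightarrow> smooth_on T f"
  unfolding smooth_on_def by (blast intro: times_differentiable_on_subset)

lemma smooth_on_locally:
  "(\<And>x. x \<in> S \<Longrightarrow> \<exists>U. open U \<and> x \<in> U \<and> smooth_on U f) \<Longrightarrow> smooth_on S f"
  unfolding smooth_on_def by (intro allI times_differentiable_on_locally) blast

lemma smooth_on_const: "open S \<Longrightarrow> smooth_on S (\<lambda>x. c)"
  by (simp add: smooth_on_def times_differentiable_on_const)

lemma smooth_on_linear: "bounded_linear f \<Longrightarrow> open S \<Longrightarrow> smooth_on S f"
  by (simp add: smooth_on_def times_differentiable_on_linear)

lemma smooth_on_add:
  "open S \<Longrightarrow> smooth_on S f \<Longrightarrow> smooth_on S g \<Longrightarrow> smooth_on S (\<lambda>x. f x + g x)"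
  by (simp add: smooth_on_def times_differentiable_on_add)

lemma smooth_on_sum:
  "open S \<Longrightarrow> (\<And>i. i \<in> I \<Longrightarrow> smooth_on S (f i)) \<Longrightarrow> smooth_on S (\<lambda>x. \<Sum>i\<in>I. f i x)"
  by (simp add: smooth_on_def times_differentiable_on_sum)

lemma (in bounded_bilinear) smooth_on:
  "open S \<Longrightarrow> smooth_on S f \<Longrightarrow> smooth_on S g \<Longrightarrow> smooth_on S (\<lambda>x. prod (f x) (g x))"
  by (simp add: smooth_on_def times_differentiable_on)

lemma smooth_on_Pair:
  "open S \<Longrightarrow> smooth_on S f \<Longrightarrow> smooth_on S g \<Longrightarrow> smooth_on S (\<lambda>x. (f x, g x))"
  by (simp add: smooth_on_def times_differentiable_on_Pair)

lemma smooth_on_compose: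
  fixes f :: "'a::real_normed_vector \<Rightarrow> 'b::euclidean_space"
  shows "open S \<Longrightarrow> open T \<Longrightarrow> f ` S \<subseteq> T \<Longrightarrow> smooth_on S f \<Longrightarrow> smooth_on T g \<Longrightarrow>
    smooth_on S (\<lambda>x. g (f x))"
  by (simp add: smooth_on_def times_differentiable_on_compose)

lemma smooth_on_has_derivative:
  "smooth_on S f \<Longrightarrow> x \<in> S \<Longrightarrow> (f has_derivative frechet_derivative f (at x)) (at x)"
  using times_differentiable_on_Suc_has_derivative smooth_on_def by blast

lemma smooth_on_frechet_derivative:
  "smooth_on S f \<Longrightarrow> smooth_on S (\<lambda>x. frechet_derivative f (at x) e)"
  unfolding smooth_on_def by (metis times_differentiable_on.simps(2))

lemma smooth_on_inverse:
  fixes f :: "'a::real_normed_vector \<Rightarrow> real"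
  assumes "open S" "smooth_on S f" "\<And>x. x \<in> S \<Longrightarrow> f x \<noteq> 0"
  shows "smooth_on S (\<lambda>x. inverse (f x))"
proof (rule smooth_on_compose[OF assms(1) _ _ assms(2)])
  show "open (- {0::real})" by auto
  show "smooth_on (- {0}) (inverse :: real \<Rightarrow> real)"
    by (simp add: smooth_on_def times_differentiable_on_inverse)
qed (use assms(3) in auto)

text \<open>The functions \<open>t \<mapsto> t\<^sup>-\<^sup>n exp (- 1 / t)\<close>, for all \<open>n\<close> at once, because their span is closed under
  differentiation.\<close>

definition flat_exp :: "nat \<Rightarrow> real \<Rightarrow> real" where
  "flat_exp n t = (if t \<le> 0 then 0 else inverse t ^ n * exp (- inverse t))"

lemma flat_exp_nonneg: "flat_exp n t \<ge> 0" and flat_exp_pos: "t > 0 \<Longrightarrow> flat_exp n t > 0"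
  by (auto simp: flat_exp_def)

text \<open>From the right, \<open>s = 1 / t\<close> reduces this to the decay of
  \<open>s ^ n / exp s\<close> at infinity; from the left the function vanishes.\<close>

lemma tendsto_flat_exp_0: "(flat_exp n \<longlongrightarrow> 0) (at 0)"
proof -
  have "((\<lambda>t. inverse t ^ n / exp (inverse t)) \<longlongrightarrow> 0) (at_right (0::real))"
    by (rule filterlim_compose[OF tendsto_power_div_exp_0 filterlim_inverse_at_top_right])
  then have "(flat_exp n \<longlongrightarrow> 0) (at_right 0)"
    by (rule Lim_transform_eventually)
      (auto simp: flat_exp_def eventually_at_filter exp_minus divide_inverse)
  moreover have "(flat_exp n \<longlongrightarrow> 0) (at_left 0)"
    by (rule Lim_transform_eventually[OF tendsto_const])
      (auto simp: flat_exp_def eventually_at_filter)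
  ultimately show ?thesis by (simp add: filterlim_split_at)
qed

lemma has_real_derivative_flat_exp:
  "(flat_exp n has_real_derivative flat_exp (n + 2) t - n * flat_exp (n + 1) t) (at t)"
proof (cases t "0::real" rule: linorder_cases)
  case less
  have "((\<lambda>t. 0) has_real_derivative 0) (at t)" by simp
  then have "(flat_exp n has_real_derivative 0) (at t)"
    by (rule has_field_derivative_transform_within_open[where S = "{..<0}"])
      (use less in \<open>auto simp: flat_exp_def\<close>)
  with less show ?thesis by (simp add: flat_exp_def)
next
  case equal
  \<comment> \<open>The difference quotient at 0 belongs to the family again: for
    \<open>h \<noteq> 0\<close> it is \<open>flat_exp (n + 1) h\<close>.\<close>
  have "((\<lambda>h. flat_exp n h / h) \<longlongrightarrow> 0) (at 0)"
    by (rule Lim_transform_eventually[OF tendsto_flat_exp_0[of "n + 1"]])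
      (auto simp: flat_exp_def eventually_at_filter field_simps)
  then have "(flat_exp n has_real_derivative 0) (at 0)"
    by (simp add: DERIV_def flat_exp_def)
  with equal show ?thesis by (simp add: flat_exp_def)
next
  case greater
  have "((\<lambda>t. inverse t ^ n * exp (- inverse t)) has_real_derivative
      flat_exp (n + 2) t - n * flat_exp (n + 1) t) (at t)"
    \<comment> \<open>The power rule produces the truncated exponent \<open>n - 1\<close>, hence the
      final case split on \<open>n\<close>.\<close>
    using greater
    by (auto intro!: derivative_eq_intros simp: flat_exp_def field_simps power2_eq_square)
      (cases n; simp add: field_simps power2_eq_square)
  then show ?thesis
    by (rule has_field_derivative_transform_within_open[where S = "{0<..}"])
      (use greater in \<open>auto simp: flat_exp_def\<close>)
qed

lemma smooth_on_flat_exp: "smooth_on UNIV (flat_exp n)"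
proof -
  have "times_differentiable_on k UNIV (flat_exp n)" for k
  proof (induction k arbitrary: n)
    case 0
    then show ?case
      using DERIV_isCont[OF has_real_derivative_flat_exp]
      by (simp add: continuous_on_eq_continuous_at)
  next
    case (Suc k)
    have "times_differentiable_on k UNIV
        (\<lambda>t. (flat_exp (n + 2) t + (- real n) * flat_exp (n + 1) t) * e)" for e
      by (intro bounded_bilinear.times_differentiable_on[OF bounded_bilinear_mult]
          times_differentiable_on_const times_differentiable_on_add Suc open_UNIV)
    then show ?case
      using has_real_derivative_flat_exp[of n]
      by (intro times_differentiable_onI[where
            f' = "\<lambda>t e. (flat_exp (n + 2) t - n * flat_exp (n + 1) t) * e"])
        (auto simp: has_field_derivative_def)
  qed
  then show ?thesis by (simp add: smooth_on_def)
qed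

lemma smooth_bump_exists:
  fixes a :: "'a::euclidean_space"
  assumes "0 < r" "r < R"
  obtains h :: "'a \<Rightarrow> real" where "smooth_on UNIV h"
    "\<And>x. x \<in> ball a r \<Longrightarrow> h x = 1" "\<And>x. x \<notin> cball a R \<Longrightarrow> h x = 0"
proof
  let ?s = "\<lambda>x. (x - a) \<bullet> (x - a)"
  \<comment> \<open>\<open>?f\<close> is positive exactly inside radius \<open>R\<close>, and
    \<open>?g\<close> exactly outside radius \<open>r\<close>. As \<open>r < R\<close>, they never
    vanish together, so \<open>?f / (?f + ?g)\<close> is smooth; it is 1 where \<open>?g\<close>
    vanishes and 0 where \<open>?f\<close> does. The squared distance keeps the centre
    smooth.\<close>
  let ?f = "\<lambda>x. flat_exp 0 (R\<^sup>2 + (-1) * ?s x)" and ?g = "\<lambda>x. flat_exp 0 (?s x + - r\<^sup>2)"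
  let ?h = "\<lambda>x. ?f x * inverse (?f x + ?g x)"
  have "r\<^sup>2 < R\<^sup>2" using assms by (intro power_strict_mono) auto
  then have pos: "?f x + ?g x > 0" for x
    using flat_exp_pos[of "R\<^sup>2 + (-1) * ?s x" 0] flat_exp_pos[of "?s x + - r\<^sup>2" 0]
      flat_exp_nonneg[of 0 "R\<^sup>2 + (-1) * ?s x"] flat_exp_nonneg[of 0 "?s x + - r\<^sup>2"]
    by (cases "?s x < R\<^sup>2") auto
  have s1: "smooth_on UNIV (\<lambda>x. x + - a)"
    by (intro smooth_on_add smooth_on_const smooth_on_linear bounded_linear_ident open_UNIV)
  then have s: "smooth_on UNIV ?s"
    using bounded_bilinear.smooth_on[OF bounded_bilinear_inner open_UNIV s1 s1] by simp
  have f: "smooth_on UNIV ?f"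
    by (rule smooth_on_compose[OF open_UNIV open_UNIV subset_UNIV _ smooth_on_flat_exp])
      (intro smooth_on_add smooth_on_const s bounded_bilinear.smooth_on[OF bounded_bilinear_mult]
        open_UNIV)
  have g: "smooth_on UNIV ?g"
    by (rule smooth_on_compose[OF open_UNIV open_UNIV subset_UNIV _ smooth_on_flat_exp])
      (intro smooth_on_add smooth_on_const s open_UNIV)
  have "smooth_on UNIV (\<lambda>x. inverse (?f x + ?g x))"
    by (rule smooth_on_inverse[OF open_UNIV smooth_on_add[OF open_UNIV f g]])
      (use pos in \<open>metis less_irrefl\<close>)
  then show "smooth_on UNIV ?h"
    by (rule bounded_bilinear.smooth_on[OF bounded_bilinear_mult open_UNIV f])
  fix x
  have n: "?s x = (dist a x)\<^sup>2" by (metis dist_commute dist_norm power2_norm_eq_inner)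
  {
    assume "x \<in> ball a r"
    then have "?g x = 0" using assms by (simp add: n flat_exp_def)
    with pos[of x] show "?h x = 1" by simp
  next
    assume "x \<notin> cball a R"
    then have "?f x = 0" using assms by (simp add: n flat_exp_def)
    then show "?h x = 0" by simp
  }
qed


subsection \<open>Atlases and the chain rule\<close>

text \<open>Exactly what the chain rule between charts uses, isolated so that the same facts serve
  the manifold, its tangent bundle and its frame bundle.\<close>

locale C1_atlas =
  fixes A :: "('m, 'e::real_normed_vector) atlas"
  assumes inj_chart: "c \<in> A \<Longrightarrow> inj_on (snd c) (fst c)"
    and open_overlap: "c \<in> A \<Longrightarrow> d \<in> A \<Longrightarrow> open (snd c ` (fst c \<inter> fst d))"
    and transition_differentiable: "c \<in> A \<Longrightarrow> d \<in> A \<Longrightarrow> x \<in> snd c ` (fst c \<inter> fst d) \<Longrightarrow>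
      (snd d \<circ> chart_inv c) differentiable (at x)"
begin

lemma charts_atD: "c \<in> charts_at A p \<Longrightarrow> c \<in> A" "c \<in> charts_at A p \<Longrightarrow> p \<in> fst c"
  by (auto simp: charts_at_def)

lemma open_chart_image: "c \<in> A \<Longrightarrow> open (snd c ` fst c)"
  using open_overlap[of c c] by simp

lemma chart_inv_chart: "c \<in> A \<Longrightarrow> p \<in> fst c \<Longrightarrow> chart_inv c (snd c p) = p"
  by (simp add: chart_inv_def inj_chart)

lemma chart_inv_in: "x \<in> snd c ` fst c \<Longrightarrow> chart_inv c x \<in> fst c"
  by (simp add: chart_inv_def inv_into_into)

lemma chart_chart_inv: "x \<in> snd c ` fst c \<Longrightarrow> snd c (chart_inv c x) = x"
  by (simp add: chart_inv_def f_inv_into_f)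

lemma transition_has_derivative:
  assumes "c \<in> charts_at A p" "d \<in> charts_at A p"
  shows "((snd d \<circ> chart_inv c) has_derivative
    frechet_derivative (snd d \<circ> chart_inv c) (at (snd c p))) (at (snd c p))"
  unfolding frechet_derivative_works[symmetric]
  by (rule transition_differentiable) (use assms in \<open>auto simp: charts_at_def\<close>)

lemma open_transition_vimage:
  assumes "c \<in> A" "d \<in> A" "open W"
  shows "open {y \<in> snd c ` (fst c \<inter> fst d). snd d (chart_inv c y) \<in> W}"
proof -
  have "continuous_on (snd c ` (fst c \<inter> fst d)) (snd d \<circ> chart_inv c)"
    using transition_differentiable[OF assms(1,2)]
    by (intro continuous_at_imp_continuous_on ballI differentiable_imp_continuous_within)
  from continuous_open_preimage[OF this open_overlap[OF assms(1,2)] assms(3)]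
  show ?thesis by (simp add: vimage_def Int_def conj_commute)
qed

lemma frechet_derivative_transition_self:
  assumes "c \<in> charts_at A p"
  shows "frechet_derivative (snd c \<circ> chart_inv c) (at (snd c p)) = (\<lambda>e. e)"
proof (rule frechet_derivative_eq, rule has_derivative_transform_within_open)
  show "((\<lambda>x. x) has_derivative (\<lambda>e. e)) (at (snd c p))" by (rule has_derivative_ident)
  show "open (snd c ` fst c)" using assms by (simp add: open_chart_image charts_atD)
qed (use assms in \<open>auto simp: chart_inv_chart charts_atD\<close>)

lemma coord_vec_same: "c \<in> charts_at A p \<Longrightarrow> snd (coord_vec A c p e) c = e"
  by (simp add: coord_vec_def frechet_derivative_transition_self)

lemma tangent_spaceE:
  assumes "w \<in> tangent_space A p"
  obtains "fst w = p" "\<And>c. c \<notin> charts_at A p \<Longrightarrow> snd w c = 0"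
    "\<And>c d. c \<in> charts_at A p \<Longrightarrow> d \<in> charts_at A p \<Longrightarrow>
      snd w d = frechet_derivative (snd d \<circ> chart_inv c) (at (snd c p)) (snd w c)"
proof -
  obtain V where "w = (p, V)" "\<forall>c. c \<notin> charts_at A p \<longrightarrow> V c = 0"
    "\<forall>c\<in>charts_at A p. \<forall>d\<in>charts_at A p.
        V d = frechet_derivative (snd d \<circ> chart_inv c) (at (snd c p)) (V c)"
    using assms unfolding tangent_space_def by blast
  then show ?thesis using that by (metis fst_conv snd_conv)
qed

lemma tangent_space_trans:
  "w \<in> tangent_space A p \<Longrightarrow> c \<in> charts_at A p \<Longrightarrow> d \<in> charts_at A p \<Longrightarrow>
    snd w d = frechet_derivative (snd d \<circ> chart_inv c) (at (snd c p)) (snd w c)"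
  by (rule tangent_spaceE)

lemma tangent_space_fst: "w \<in> tangent_space A p \<Longrightarrow> fst w = p"
  by (rule tangent_spaceE)

lemma tangent_spaceI:
  assumes "fst w = p" "\<And>c. c \<notin> charts_at A p \<Longrightarrow> snd w c = 0"
    "\<And>c d. c \<in> charts_at A p \<Longrightarrow> d \<in> charts_at A p \<Longrightarrow>
      snd w d = frechet_derivative (snd d \<circ> chart_inv c) (at (snd c p)) (snd w c)"
  shows "w \<in> tangent_space A p"
  unfolding tangent_space_def
proof (intro CollectI exI conjI allI impI ballI)
  show "w = (p, snd w)" using assms(1) by (metis prod.collapse)
qed (fact assms)+

lemma tangent_space_eq_coord_vec:
  assumes "w \<in> tangent_space A p" "c \<in> charts_at A p"
  shows "w = coord_vec A c p (snd w c)"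
proof (rule prod_eqI)
  show "fst w = fst (coord_vec A c p (snd w c))"
    using tangent_space_fst[OF assms(1)] by (simp add: coord_vec_def)
  have "snd w d = snd (coord_vec A c p (snd w c)) d" for d
    using assms by (cases "d \<in> charts_at A p") (auto simp: coord_vec_def elim: tangent_spaceE)
  then show "snd w = snd (coord_vec A c p (snd w c))" ..
qed

lemma tangent_space_eqI:
  assumes "w \<in> tangent_space A p" "w' \<in> tangent_space A p" "c \<in> charts_at A p" "snd w c = snd w' c"
  shows "w = w'"
  using tangent_space_eq_coord_vec assms by metis

text \<open>The representations of a differentiable map in any two pairs of charts are related by the
  chain rule; only a neighbourhood of the point matters.\<close>

lemma has_derivative_change_source_chart:
  assumes c: "c \<in> charts_at A p" and c': "c' \<in> charts_at A p"
    and F: "((f \<circ> chart_inv c) has_derivative F) (at (snd c p))"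
  shows "((f \<circ> chart_inv c') has_derivative
    F \<circ> frechet_derivative (snd c \<circ> chart_inv c') (at (snd c' p))) (at (snd c' p))"
proof (rule has_derivative_transform_within_open)
  have p: "chart_inv c' (snd c' p) = p" using c' by (simp add: chart_inv_chart charts_atD)
  show "((f \<circ> chart_inv c) \<circ> (snd c \<circ> chart_inv c') has_derivative
      F \<circ> frechet_derivative (snd c \<circ> chart_inv c') (at (snd c' p))) (at (snd c' p))"
    by (rule diff_chain_at[OF transition_has_derivative[OF c' c]]) (simp add: p F)
  show "open (snd c' ` (fst c' \<inter> fst c))" using c c' by (simp add: open_overlap charts_atD)
  show "snd c' p \<in> snd c' ` (fst c' \<inter> fst c)" using c c' by (simp add: charts_atD)
  show "(f \<circ> chart_inv c \<circ> (snd c \<circ> chart_inv c')) y = (f \<circ> chart_inv c') y"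
    if "y \<in> snd c' ` (fst c' \<inter> fst c)" for y
    using that c c' by (auto simp: chart_inv_chart charts_atD)
qed

text \<open>Removes the arbitrary chart from the definition: the transition derivative picked up by
  the representation of \<open>f\<close> is absorbed by the coordinate vector of
  \<open>w\<close>.\<close>

lemma derivative_along_eq:
  assumes c: "c \<in> charts_at A p" and w: "w \<in> tangent_space A p"
    and F: "((f \<circ> chart_inv c) has_derivative F) (at (snd c p))"
  shows "derivative_along A w f = F (snd w c)"
proof -
  define c' where "c' = (SOME c. c \<in> charts_at A p)"
  have c': "c' \<in> charts_at A p" unfolding c'_def using c by (rule someI)
  show ?thesis
    using w frechet_derivative_eq[OF has_derivative_change_source_chart[OF c c' F]]
      tangent_space_trans[OF w c' c]
    by (simp add: derivative_along_def tangent_space_fst c'_def[symmetric])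
qed

text \<open>This is the cocycle identity of the transition derivatives; it makes
  \<open>coord_vec\<close> a compatible family, that is, a tangent vector.\<close>

lemma coord_vec_change_chart:
  assumes "c \<in> charts_at A p" "d \<in> charts_at A p"
  shows "coord_vec A c p e =
    coord_vec A d p (frechet_derivative (snd d \<circ> chart_inv c) (at (snd c p)) e)"
proof -
  have *: "frechet_derivative (snd b \<circ> chart_inv c) (at (snd c p)) e =
      frechet_derivative (snd b \<circ> chart_inv d) (at (snd d p))
        (frechet_derivative (snd d \<circ> chart_inv c) (at (snd c p)) e)"
    if b: "b \<in> charts_at A p" for b
    by (simp only: o_apply frechet_derivative_eq[OF has_derivative_change_source_chart[OF assms(2,1)
          transition_has_derivative[OF assms(2) b]]])
  let ?e = "frechet_derivative (snd d \<circ> chart_inv c) (at (snd c p)) e"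
  have "snd (coord_vec A c p e) b = snd (coord_vec A d p ?e) b" for b
    using *[of b] by (cases "b \<in> charts_at A p") (simp_all add: coord_vec_def del: o_apply)
  then show ?thesis by (intro prod_eqI ext) (simp_all add: coord_vec_def)
qed

lemma coord_vec_in_tangent_space:
  assumes c: "c \<in> charts_at A p"
  shows "coord_vec A c p e \<in> tangent_space A p"
proof -
  have *: "snd (coord_vec A c p e) d = frechet_derivative (snd d \<circ> chart_inv b) (at (snd b p))
      (snd (coord_vec A c p e) b)" if "b \<in> charts_at A p" "d \<in> charts_at A p" for b d
  proof -
    have "snd (coord_vec A c p e) d = snd (coord_vec A b p
        (frechet_derivative (snd b \<circ> chart_inv c) (at (snd c p)) e)) d"
      by (simp only: coord_vec_change_chart[OF c that(1)])
    also have "\<dots> = frechet_derivative (snd d \<circ> chart_inv b) (at (snd b p))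
        (frechet_derivative (snd b \<circ> chart_inv c) (at (snd c p)) e)"
      using that by (simp add: coord_vec_def)
    finally show ?thesis using that by (simp add: coord_vec_def)
  qed
  show ?thesis
    by (rule tangent_spaceI[OF _ _ *]) (simp_all add: coord_vec_def)
qed

lemma tv_add_coord_vec:
  assumes "c \<in> charts_at A p"
  shows "tv_add (coord_vec A c p a) (coord_vec A c p b) = coord_vec A c p (a + b)"
  by (intro prod_eqI ext) (simp_all add: tv_add_def coord_vec_def
      linear_add[OF has_derivative_linear[OF transition_has_derivative[OF assms]]])

lemma tv_scale_coord_vec:
  assumes "c \<in> charts_at A p"
  shows "tv_scale r (coord_vec A c p a) = coord_vec A c p (r *\<^sub>R a)"
  by (intro prod_eqI ext) (simp_all add: tv_scale_def coord_vec_def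
      linear_scale[OF has_derivative_linear[OF transition_has_derivative[OF assms]]])

end

text \<open>Evaluates a tangent map in charts of one's own choice. The set \<open>W\<close> ensures
  that \<open>f\<close> stays in the domain of \<open>d\<close> near the point, where
  \<open>chart_inv d\<close> undoes \<open>snd d\<close>; without this the representations in
  \<open>d\<close> and in another chart would not be comparable.\<close>

lemma tangent_map_eq_coord_vec:
  assumes A: "C1_atlas A" and B: "C1_atlas B"
    and c: "c \<in> charts_at A p" and d: "d \<in> charts_at B (f p)"
    and w: "w \<in> tangent_space A p"
    and W: "open W" "snd c p \<in> W" "W \<subseteq> snd c ` fst c" "\<And>y. y \<in> W \<Longrightarrow> f (chart_inv c y) \<in> fst d"
    and F: "((snd d \<circ> f \<circ> chart_inv c) has_derivative F) (at (snd c p))"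
  shows "tangent_map A B f w = coord_vec B d (f p) (F (snd w c))"
proof -
  interpret A: C1_atlas A by fact
  interpret B: C1_atlas B by fact
  define c' where "c' = (SOME c. c \<in> charts_at A p)"
  have c': "c' \<in> charts_at A p" unfolding c'_def using c by (rule someI)
  have p: "chart_inv c (snd c p) = p" using c by (simp add: A.chart_inv_chart A.charts_atD)
  have "frechet_derivative (snd b \<circ> f \<circ> chart_inv c') (at (snd c' p)) (snd w c') =
      frechet_derivative (snd b \<circ> chart_inv d) (at (snd d (f p))) (F (snd w c))"
    if b: "b \<in> charts_at B (f p)" for b
  proof -
    define F' where "F' = frechet_derivative (snd b \<circ> chart_inv d) (at (snd d (f p))) \<circ> F"
    define W' where "W' = {y \<in> W. snd d (f (chart_inv c y)) \<in> snd d ` (fst d \<inter> fst b)}"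
    have 1: "((snd b \<circ> chart_inv d) \<circ> (snd d \<circ> f \<circ> chart_inv c) has_derivative F') (at (snd c p))"
      unfolding F'_def
      by (rule diff_chain_at[OF F]) (simp add: p B.transition_has_derivative[OF d b])
    have "\<forall>\<^sub>F y in nhds (snd c p). (snd d \<circ> f \<circ> chart_inv c) y \<in> snd d ` (fst d \<inter> fst b)"
    proof (rule topological_tendstoD[OF _ B.open_overlap])
      show "((snd d \<circ> f \<circ> chart_inv c) \<longlongrightarrow> snd d (f p)) (nhds (snd c p))"
        using has_derivative_continuous[OF F]
        by (simp add: continuous_at p tendsto_nhds_iff)
    qed (use b d in \<open>auto simp: B.charts_atD\<close>)
    moreover have "\<forall>\<^sub>F y in nhds (snd c p). y \<in> W" using W by (simp add: eventually_nhds_in_open)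
    ultimately have ev: "\<forall>\<^sub>F y in nhds (snd c p).
        ((snd b \<circ> chart_inv d) \<circ> (snd d \<circ> f \<circ> chart_inv c)) y = (snd b \<circ> f \<circ> chart_inv c) y"
    proof eventually_elim
      case (elim y)
      then have "f (chart_inv c y) \<in> fst d" using W by blast
      then show ?case using d by (simp add: B.chart_inv_chart B.charts_atD)
    qed
    have "((snd b \<circ> f \<circ> chart_inv c) has_derivative F') (at (snd c p))"
    proof (rule has_derivative_transform_eventually[OF 1])
      show "\<forall>\<^sub>F y in at (snd c p). ((snd b \<circ> chart_inv d) \<circ> (snd d \<circ> f \<circ> chart_inv c)) y =
          (snd b \<circ> f \<circ> chart_inv c) y"
        unfolding eventually_at_filter using ev by (rule eventually_mono) simp
    qed (use eventually_nhds_x_imp_x[OF ev] in simp_all)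
    then have "((snd b \<circ> f) \<circ> chart_inv c' has_derivative
        F' \<circ> frechet_derivative (snd c \<circ> chart_inv c') (at (snd c' p))) (at (snd c' p))"
      by (intro A.has_derivative_change_source_chart[OF c c']) (simp add: o_assoc)
    from frechet_derivative_eq[OF this] show ?thesis
      using A.tangent_space_trans[OF w c' c] by (simp add: F'_def)
  qed
  then show ?thesis
    using w by (auto simp: tangent_map_def coord_vec_def A.tangent_space_fst c'_def[symmetric])
qed


subsection \<open>The tangent bundle and the frame bundle as atlases\<close>

lemma bounded_bilinear_matrix_vector_mult:
  "bounded_bilinear ((*v) :: real^'n^'m \<Rightarrow> real^'n \<Rightarrow> real^'m)"
  unfolding bilinear_conv_bounded_bilinear[symmetric] bilinear_def
  by (auto intro!: linearI simp: algebra_simps scaleR_matrix_vector_assoc)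

lemma bounded_bilinear_matrix_matrix_mult:
  "bounded_bilinear ((**) :: real^'n^'m \<Rightarrow> real^'k^'n \<Rightarrow> real^'k^'m)"
  unfolding bilinear_conv_bounded_bilinear[symmetric] bilinear_def
  by (auto intro!: linearI
      simp: matrix_matrix_mult_def vec_eq_iff sum.distrib sum_distrib_left algebra_simps)

lemma open_invertible: "open {m :: real^'n^'n. invertible m}"
proof -
  have "open {m :: real^'n^'n. det m \<noteq> 0}"
    unfolding det_def by (intro open_Collect_neq continuous_intros)
  then show ?thesis by (simp add: invertible_det_nz)
qed

lemma
  assumes "invertible (m :: 'a::semiring_1^'n^'m)"
  shows matrix_inv_right: "m ** matrix_inv m = mat 1" and matrix_inv_left: "matrix_inv m ** m = mat 1"
  using someI_ex[OF assms[unfolded invertible_def]] by (auto simp: matrix_inv_def)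

lemma smooth_on_fst:
  fixes f :: "'a::euclidean_space \<Rightarrow> 'c::real_normed_vector"
  assumes "open S" "smooth_on S f"
  shows "smooth_on (S \<times> (UNIV :: 'b::real_normed_vector set)) (\<lambda>z. f (fst z))"
  by (rule smooth_on_compose[OF _ assms(1) _ _ assms(2)])
    (auto intro!: smooth_on_linear bounded_linear_fst open_Times assms(1))

text \<open>The fibre part of a tangent bundle transition has this form. Both arguments vary, so the
  direction is again expanded in a basis.\<close>

lemma smooth_on_frechet_derivative_snd:
  fixes f :: "'a::euclidean_space \<Rightarrow> 'c::real_normed_vector"
  assumes S: "open S" "smooth_on S f"
  shows "smooth_on (S \<times> UNIV) (\<lambda>z. frechet_derivative f (at (fst z)) (snd z))"
proof (rule smooth_on_cong)
  show o: "open (S \<times> (UNIV :: 'a set))" by (simp add: open_Times S)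
  show "smooth_on (S \<times> UNIV)
      (\<lambda>z. \<Sum>b\<in>Basis. (snd z \<bullet> b) *\<^sub>R frechet_derivative f (at (fst z)) b)"
    by (intro smooth_on_sum bounded_bilinear.smooth_on[OF bounded_bilinear_scaleR]
        smooth_on_fst smooth_on_frechet_derivative S o smooth_on_linear
        bounded_linear_inner_left_comp bounded_linear_snd)
  show "(\<Sum>b\<in>Basis. (snd z \<bullet> b) *\<^sub>R frechet_derivative f (at (fst z)) b) =
      frechet_derivative f (at (fst z)) (snd z)" if "z \<in> S \<times> UNIV" for z
    using that S(2)
    by (intro linear_eq_sum_Basis[symmetric] has_derivative_linear[OF smooth_on_has_derivative]) auto
qed

text \<open>A matrix is the sum of its columns, each placed by a fixed linear map
  \<open>col j\<close>; hence smoothness for each fixed vector suffices. It is applied to the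
  Jacobians in the frame bundle transitions.\<close>

lemma smooth_on_matrix:
  fixes L :: "'a::real_normed_vector \<Rightarrow> real^'n \<Rightarrow> real^'m"
  assumes "open S" "\<And>e. smooth_on S (\<lambda>x. L x e)"
  shows "smooth_on S (\<lambda>x. matrix (L x))"
proof -
  define col :: "'n \<Rightarrow> real^'m \<Rightarrow> real^'n^'m" where "col j v = (\<chi> i k. if k = j then v $ i else 0)" for j v
  have "linear (col j)" for j
    by (auto intro!: linearI simp: col_def vec_eq_iff)
  then have col: "bounded_linear (col j)" for j by (simp add: linear_conv_bounded_linear)
  have "smooth_on S (\<lambda>x. col j (L x (axis j 1)))" for j
    by (rule smooth_on_compose[OF assms(1) open_UNIV subset_UNIV assms(2)
          smooth_on_linear[OF col open_UNIV]])
  then have "smooth_on S (\<lambda>x. \<Sum>j\<in>UNIV. col j (L x (axis j 1)))"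
    by (intro smooth_on_sum assms(1))
  moreover have "(\<Sum>j\<in>UNIV. col j (L x (axis j 1))) = matrix (L x)" for x
    by (simp add: vec_eq_iff matrix_def col_def)
  ultimately show ?thesis by simp
qed

abbreviation transition_derivative ::
    "('m, 'e::real_normed_vector) chart \<Rightarrow> ('m, 'e) chart \<Rightarrow> 'e \<Rightarrow> 'e \<Rightarrow> 'e" where
  "transition_derivative c d x \<equiv> frechet_derivative (snd d \<circ> chart_inv c) (at x)"

lemma chart_inv_eqI: "inj_on (snd c) (fst c) \<Longrightarrow> p \<in> fst c \<Longrightarrow> snd c p = x \<Longrightarrow> chart_inv c x = p"
  by (auto simp: chart_inv_def)

locale smooth_atlas =
  fixes A :: "('m, 'e::euclidean_space) atlas"
  assumes smooth: "smooth_manifold A"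
begin

lemma smooth_transition:
  "c \<in> A \<Longrightarrow> d \<in> A \<Longrightarrow> smooth_on (snd c ` (fst c \<inter> fst d)) (snd d \<circ> chart_inv c)"
  using smooth by (simp add: smooth_manifold_def)

end

sublocale smooth_atlas \<subseteq> C1_atlas A
proof
  show "inj_on (snd c) (fst c)" if "c \<in> A" for c
    using smooth that unfolding smooth_manifold_def by blast
  show "open (snd c ` (fst c \<inter> fst d))" if "c \<in> A" "d \<in> A" for c d
    using smooth that unfolding smooth_manifold_def by blast
  show "(snd d \<circ> chart_inv c) differentiable (at x)"
    if "c \<in> A" "d \<in> A" "x \<in> snd c ` (fst c \<inter> fst d)" for c d x
    using smooth_on_has_derivative[OF smooth_transition[OF that(1,2)] that(3)]
    by (auto simp: differentiable_def)
qed

section \<open>The canonical charts of the tangent bundle\<close>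

context smooth_atlas
begin

lemma tangent_bundleD:
  "v \<in> tangent_bundle A \<Longrightarrow> v \<in> tangent_space A (fst v)"
  "v \<in> tangent_bundle A \<Longrightarrow> fst v \<in> manifold_carrier A"
  by (auto simp: tangent_bundle_def dest: tangent_space_fst)

lemma coord_vec_in_tangent_bundle:
  "c \<in> charts_at A p \<Longrightarrow> coord_vec A c p e \<in> tangent_bundle A"
  using coord_vec_in_tangent_space
  by (fastforce simp: tangent_bundle_def manifold_carrier_def charts_at_def)

lemma charts_at_chart_inv: "c \<in> A \<Longrightarrow> x \<in> snd c ` fst c \<Longrightarrow> c \<in> charts_at A (chart_inv c x)"
  by (simp add: charts_at_def chart_inv_in)

lemma fst_coord_vec: "fst (coord_vec A c p e) = p"
  by (simp add: coord_vec_def)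

lemma inj_on_tangent_chart:
  assumes "c \<in> A"
  shows "inj_on (snd (tangent_chart A c)) (fst (tangent_chart A c))"
proof (rule inj_onI)
  fix v w assume *: "v \<in> fst (tangent_chart A c)" "w \<in> fst (tangent_chart A c)"
    "snd (tangent_chart A c) v = snd (tangent_chart A c) w"
  then have vw: "v \<in> tangent_bundle A" "w \<in> tangent_bundle A" "fst v \<in> fst c" "fst w \<in> fst c"
    "snd c (fst v) = snd c (fst w)" "snd v c = snd w c" by (auto simp: tangent_chart_def)
  then have "fst v = fst w" using inj_chart[OF assms] by (simp add: inj_on_def)
  then show "v = w"
    using vw assms tangent_bundleD(1)[OF vw(1)] tangent_bundleD(1)[OF vw(2)]
    by (intro tangent_space_eqI[of v "fst v" w c]) (auto simp: charts_at_def)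
qed

lemma tangent_chart_coord_vec:
  assumes "c \<in> charts_at A p"
  shows "coord_vec A c p v \<in> fst (tangent_chart A c)"
    and "snd (tangent_chart A c) (coord_vec A c p v) = (snd c p, v)"
  using assms coord_vec_in_tangent_bundle[OF assms]
  by (auto simp: tangent_chart_def fst_coord_vec coord_vec_same charts_atD)

lemma tangent_chart_image:
  assumes "c \<in> A"
  shows "snd (tangent_chart A c) ` (fst (tangent_chart A c) \<inter> fst (tangent_chart A d)) =
    (snd c ` (fst c \<inter> fst d)) \<times> UNIV"
proof (intro equalityI subsetI)
  fix z assume "z \<in> (snd c ` (fst c \<inter> fst d)) \<times> (UNIV :: 'e set)"
  then obtain p v where z: "z = (snd c p, v)" "p \<in> fst c" "p \<in> fst d" by auto
  with assms have c: "c \<in> charts_at A p" by (simp add: charts_at_def)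
  show "z \<in> snd (tangent_chart A c) ` (fst (tangent_chart A c) \<inter> fst (tangent_chart A d))"
    using tangent_chart_coord_vec[OF c, of v] z coord_vec_in_tangent_bundle[OF c, of v]
    by (intro image_eqI[where x = "coord_vec A c p v"])
      (auto simp: fst_coord_vec tangent_chart_def)
qed (auto simp: tangent_chart_def)

lemma chart_inv_tangent_chart:
  assumes "c \<in> A" "x \<in> snd c ` fst c"
  shows "chart_inv (tangent_chart A c) (x, v) = coord_vec A c (chart_inv c x) v"
  by (rule chart_inv_eqI[OF inj_on_tangent_chart])
    (simp_all add: assms tangent_chart_coord_vec charts_at_chart_inv chart_chart_inv)

lemma tangent_transition:
  assumes "c \<in> A" "d \<in> A" "x \<in> snd c ` (fst c \<inter> fst d)"
  shows "(snd (tangent_chart A d) \<circ> chart_inv (tangent_chart A c)) (x, v) =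
    ((snd d \<circ> chart_inv c) x, transition_derivative c d x v)"
proof -
  have x: "x \<in> snd c ` fst c" using assms(3) by blast
  have "chart_inv c x \<in> fst d" using assms(1,3) by (auto simp: chart_inv_chart)
  then have "d \<in> charts_at A (chart_inv c x)" using assms by (simp add: charts_at_def)
  then show ?thesis
    by (simp only: o_apply chart_inv_tangent_chart[OF assms(1) x])
      (simp add: tangent_chart_def coord_vec_def chart_chart_inv[OF x])
qed

text \<open>The transitions contain first derivatives of those of \<open>A\<close>, so their
  differentiability draws on second derivatives of the latter.\<close>

lemma C1_atlas_tangent_atlas: "C1_atlas (tangent_atlas A)"
proof
  fix c' d' assume "c' \<in> tangent_atlas A" "d' \<in> tangent_atlas A"
  then obtain c d where c: "c \<in> A" "c' = tangent_chart A c" and d: "d \<in> A" "d' = tangent_chart A d"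
    by (auto simp: tangent_atlas_def)
  show "inj_on (snd c') (fst c')" using c inj_on_tangent_chart by simp
  show o: "open (snd c' ` (fst c' \<inter> fst d'))"
    by (simp add: c d tangent_chart_image open_Times open_overlap)
  fix z assume z: "z \<in> snd c' ` (fst c' \<inter> fst d')"
  let ?U = "snd c ` (fst c \<inter> fst d)"
  have "smooth_on (snd c' ` (fst c' \<inter> fst d')) (snd d' \<circ> chart_inv c')"
  proof (rule smooth_on_cong[OF o])
    show "smooth_on (snd c' ` (fst c' \<inter> fst d'))
      (\<lambda>z. ((snd d \<circ> chart_inv c) (fst z), transition_derivative c d (fst z) (snd z)))"
      unfolding c d tangent_chart_image[OF c(1)]
      by (intro smooth_on_Pair smooth_on_fst smooth_on_frechet_derivative_snd smooth_transition
          open_overlap open_Times open_UNIV c d)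
  next
    fix z assume "z \<in> snd c' ` (fst c' \<inter> fst d')"
    then have "fst z \<in> ?U" by (auto simp: c d tangent_chart_image)
    from tangent_transition[OF c(1) d(1) this, of "snd z"]
    show "((snd d \<circ> chart_inv c) (fst z), transition_derivative c d (fst z) (snd z)) =
      (snd d' \<circ> chart_inv c') z" by (simp add: c d)
  qed
  from smooth_on_has_derivative[OF this z] show "(snd d' \<circ> chart_inv c') differentiable (at z)"
    by (auto simp: differentiable_def)
qed

end

section \<open>Frames as invertible matrices; the charts of the frame bundle\<close>

definition chart_frame ::
    "('m, real^'n) atlas \<Rightarrow> ('m, real^'n) chart \<Rightarrow> 'm \<Rightarrow> real^'n^'n \<Rightarrow> ('m, 'n) frame" where
  "chart_frame A c p m = (\<lambda>\<xi>. coord_vec A c p (m *v \<xi>))"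

locale smooth_frame_atlas = smooth_atlas A for A :: "('m, real^'n) atlas"
begin

lemma frame_proj_chart_frame: "frame_proj (chart_frame A c p m) = p"
  by (simp add: frame_proj_def chart_frame_def coord_vec_def)

lemma frames_at_proj: "u \<in> frames_at A p \<Longrightarrow> frame_proj u = p"
  unfolding frames_at_def frame_proj_def bij_betw_def using tangent_space_fst by blast

lemma frame_bundleD:
  "u \<in> frame_bundle A \<Longrightarrow> u \<in> frames_at A (frame_proj u)"
  by (auto simp: frame_bundle_def dest: frames_at_proj)

lemma frames_at_in_bundle:
  "c \<in> charts_at A p \<Longrightarrow> u \<in> frames_at A p \<Longrightarrow> u \<in> frame_bundle A"
  by (auto simp: frame_bundle_def manifold_carrier_def charts_at_def)

lemma chart_frame_in_frames_at:
  assumes c: "c \<in> charts_at A p" and m: "invertible m"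
  shows "chart_frame A c p m \<in> frames_at A p"
proof -
  let ?u = "chart_frame A c p m"
  have "bij_betw ?u UNIV (tangent_space A p)"
  proof (rule bij_betw_byWitness[where f' = "\<lambda>w. matrix_inv m *v snd w c"])
    show "\<forall>\<xi>\<in>UNIV. matrix_inv m *v snd (?u \<xi>) c = \<xi>"
      using m by (simp add: chart_frame_def coord_vec_same[OF c] matrix_vector_mul_assoc matrix_inv_left)
    show "\<forall>w\<in>tangent_space A p. ?u (matrix_inv m *v snd w c) = w"
      using m tangent_space_eq_coord_vec[OF _ c]
      by (simp add: chart_frame_def matrix_vector_mul_assoc matrix_inv_right)
  qed (auto simp: chart_frame_def coord_vec_in_tangent_space[OF c])
  moreover have "linear (\<lambda>\<xi>. snd (?u \<xi>) d)" for d
  proof (cases "d \<in> charts_at A p")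
    case True
    have "linear (\<lambda>\<xi>. transition_derivative c d (snd c p) (m *v \<xi>))"
      using linear_compose[OF matrix_vector_mul_linear
          has_derivative_linear[OF transition_has_derivative[OF c True]]] by (simp add: o_def)
    with True show ?thesis by (simp add: chart_frame_def coord_vec_def)
  qed (simp add: chart_frame_def coord_vec_def linear_zero)
  ultimately show ?thesis by (simp add: frames_at_def)
qed

text \<open>The columns of \<open>m\<close> are the coordinate vectors of the frame. The matrix is
  injective because \<open>u\<close> is and because coordinates in \<open>c\<close> determine a
  vector at \<open>p\<close>; being square, it is invertible.\<close>

lemma frames_atE:
  assumes c: "c \<in> charts_at A p" and u: "u \<in> frames_at A p"
  obtains m where "invertible m" "u = chart_frame A c p m"
proof
  let ?m = "matrix (\<lambda>\<xi>. snd (u \<xi>) c)"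
  have lin: "linear (\<lambda>\<xi>. snd (u \<xi>) c)" and bij: "bij_betw u UNIV (tangent_space A p)"
    using u unfolding frames_at_def by blast+
  have m: "?m *v \<xi> = snd (u \<xi>) c" for \<xi> by (rule matrix_works[OF lin[unfolded linear_matrix_vector_mul_eq[symmetric]]])
  have t: "u \<xi> \<in> tangent_space A p" for \<xi> using bij by (auto simp: bij_betw_def)
  show "u = chart_frame A c p ?m"
    using tangent_space_eq_coord_vec[OF t c] by (intro ext) (simp add: chart_frame_def m)
  have "inj ((*v) ?m)"
  proof (rule injI)
    fix \<xi> \<zeta> assume "?m *v \<xi> = ?m *v \<zeta>"
    then have "u \<xi> = u \<zeta>" using tangent_space_eqI[OF t t c] m by simp
    then show "\<xi> = \<zeta>" using bij by (auto simp: bij_betw_def inj_on_def)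
  qed
  then show "invertible ?m"
    by (simp add: matrix_left_invertible_injective[symmetric] invertible_left_inverse)
qed

lemma frame_chart_chart_frame:
  assumes "c \<in> charts_at A p"
  shows "snd (frame_chart A c) (chart_frame A c p m) = (snd c p, m)"
  by (simp add: frame_chart_def frame_proj_chart_frame)
    (simp add: chart_frame_def coord_vec_same[OF assms])

lemma frame_chart_domainE:
  assumes "c \<in> A" "u \<in> fst (frame_chart A c)"
  obtains p m where "c \<in> charts_at A p" "invertible m" "u = chart_frame A c p m"
proof -
  from assms have c: "c \<in> charts_at A (frame_proj u)" "u \<in> frames_at A (frame_proj u)"
    by (auto simp: frame_chart_def charts_at_def frame_bundleD)
  from frames_atE[OF this] that c(1) show ?thesis by metis
qed

lemma chart_frame_in_frame_chart:
  assumes "c \<in> charts_at A p" "invertible m" "p \<in> fst d"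
  shows "chart_frame A c p m \<in> fst (frame_chart A d)"
  using frames_at_in_bundle[OF assms(1) chart_frame_in_frames_at[OF assms(1,2)]] assms(3)
  by (simp add: frame_chart_def frame_proj_chart_frame)

lemma inj_on_frame_chart:
  assumes "c \<in> A"
  shows "inj_on (snd (frame_chart A c)) (fst (frame_chart A c))"
proof (rule inj_onI)
  fix u u' assume *: "u \<in> fst (frame_chart A c)" "u' \<in> fst (frame_chart A c)"
    "snd (frame_chart A c) u = snd (frame_chart A c) u'"
  from frame_chart_domainE[OF assms *(1)] obtain p m
    where u: "c \<in> charts_at A p" "u = chart_frame A c p m" by metis
  from frame_chart_domainE[OF assms *(2)] obtain p' m'
    where u': "c \<in> charts_at A p'" "u' = chart_frame A c p' m'" by metis
  from *(3) have "snd c p = snd c p'" "m = m'"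
    by (simp_all add: u u' frame_chart_chart_frame)
  then show "u = u'"
    using u u' inj_onD[OF inj_chart[OF assms], of p p'] by (simp add: charts_atD)
qed

lemma frame_chart_image:
  assumes "c \<in> A"
  shows "snd (frame_chart A c) ` (fst (frame_chart A c) \<inter> fst (frame_chart A d)) =
    (snd c ` (fst c \<inter> fst d)) \<times> {m. invertible m}"
proof (intro equalityI subsetI)
  fix z :: "(real^'n) \<times> (real^'n^'n)"
  assume "z \<in> (snd c ` (fst c \<inter> fst d)) \<times> {m. invertible m}"
  then obtain p m where z: "z = (snd c p, m)" "p \<in> fst c" "p \<in> fst d" "invertible m" by auto
  with assms have c: "c \<in> charts_at A p" by (simp add: charts_at_def)
  show "z \<in> snd (frame_chart A c) ` (fst (frame_chart A c) \<inter> fst (frame_chart A d))"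
    using frame_chart_chart_frame[OF c, of m] z chart_frame_in_frame_chart[OF c]
    by (intro image_eqI[where x = "chart_frame A c p m"]) auto
next
  fix z assume "z \<in> snd (frame_chart A c) ` (fst (frame_chart A c) \<inter> fst (frame_chart A d))"
  then obtain u where u: "u \<in> fst (frame_chart A c)" "u \<in> fst (frame_chart A d)"
    "z = snd (frame_chart A c) u" by auto
  from frame_chart_domainE[OF assms u(1)] obtain p m
    where p: "c \<in> charts_at A p" "invertible m" "u = chart_frame A c p m" by metis
  moreover have "p \<in> fst d" using u(2) p(3) by (simp add: frame_chart_def frame_proj_chart_frame)
  ultimately show "z \<in> (snd c ` (fst c \<inter> fst d)) \<times> {m. invertible m}"
    using u(3) by (auto simp: frame_chart_chart_frame charts_atD)
qed

lemma chart_inv_frame_chart: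
  assumes "c \<in> A" "x \<in> snd c ` fst c" "invertible m"
  shows "chart_inv (frame_chart A c) (x, m) = chart_frame A c (chart_inv c x) m"
  by (rule chart_inv_eqI[OF inj_on_frame_chart])
    (simp_all add: assms chart_frame_in_frame_chart charts_at_chart_inv chart_chart_inv
      frame_chart_chart_frame chart_inv_in)

lemma frame_transition:
  assumes "c \<in> A" "d \<in> A" "x \<in> snd c ` (fst c \<inter> fst d)" "invertible m"
  shows "(snd (frame_chart A d) \<circ> chart_inv (frame_chart A c)) (x, m) =
    ((snd d \<circ> chart_inv c) x, matrix (transition_derivative c d x) ** m)"
proof -
  have x: "x \<in> snd c ` fst c" using assms(3) by blast
  have "chart_inv c x \<in> fst d" using assms(1,3) by (auto simp: chart_inv_chart)
  then have d: "d \<in> charts_at A (chart_inv c x)" using assms by (simp add: charts_at_def)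
  have "linear (transition_derivative c d x)"
    using has_derivative_linear[OF transition_has_derivative[OF charts_at_chart_inv[OF assms(1) x] d]]
    by (simp add: chart_chart_inv[OF x])
  then have "matrix (\<lambda>\<xi>. transition_derivative c d x (m *v \<xi>)) = matrix (transition_derivative c d x) ** m"
    using matrix_compose[of "(*v) m" "transition_derivative c d x"] by (simp add: o_def)
  then show ?thesis using d
    by (simp only: o_apply chart_inv_frame_chart[OF assms(1) x assms(4)])
      (simp add: frame_chart_def frame_proj_chart_frame,
       simp add: chart_frame_def coord_vec_def chart_chart_inv[OF x])
qed

lemma C1_atlas_frame_atlas: "C1_atlas (frame_atlas A)"
proof
  fix c' d' assume "c' \<in> frame_atlas A" "d' \<in> frame_atlas A"
  then obtain c d where c: "c \<in> A" "c' = frame_chart A c" and d: "d \<in> A" "d' = frame_chart A d"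
    by (auto simp: frame_atlas_def)
  show "inj_on (snd c') (fst c')" using c inj_on_frame_chart by simp
  show o: "open (snd c' ` (fst c' \<inter> fst d'))"
    by (simp add: c d frame_chart_image open_Times open_overlap open_invertible)
  fix z assume z: "z \<in> snd c' ` (fst c' \<inter> fst d')"
  let ?U = "snd c ` (fst c \<inter> fst d)"
  have U: "open ?U" using open_overlap c d by simp
  have "smooth_on (snd c' ` (fst c' \<inter> fst d')) (snd d' \<circ> chart_inv c')"
  proof (rule smooth_on_cong[OF o])
    \<comment> \<open>The formula makes sense for all matrices, so smoothness is shown on a full
      product and then restricted to the invertible ones.\<close>
    have "smooth_on (?U \<times> (UNIV :: (real^'n^'n) set))
      (\<lambda>z. ((snd d \<circ> chart_inv c) (fst z), matrix (transition_derivative c d (fst z)) ** snd z))"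
      by (intro smooth_on_Pair smooth_on_fst smooth_on_matrix smooth_on_frechet_derivative
          bounded_bilinear.smooth_on[OF bounded_bilinear_matrix_matrix_mult] smooth_transition
          smooth_on_linear[OF bounded_linear_snd] U open_Times open_UNIV c d)
    then show "smooth_on (snd c' ` (fst c' \<inter> fst d'))
      (\<lambda>z. ((snd d \<circ> chart_inv c) (fst z), matrix (transition_derivative c d (fst z)) ** snd z))"
      by (rule smooth_on_subset) (auto simp: c d frame_chart_image)
  next
    fix z assume "z \<in> snd c' ` (fst c' \<inter> fst d')"
    then have "fst z \<in> ?U" "invertible (snd z)" by (auto simp: c d frame_chart_image)
    from frame_transition[OF c(1) d(1) this]
    show "((snd d \<circ> chart_inv c) (fst z), matrix (transition_derivative c d (fst z)) ** snd z) =
      (snd d' \<circ> chart_inv c') z" by (simp add: c d)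
  qed
  from smooth_on_has_derivative[OF this z] show "(snd d' \<circ> chart_inv c') differentiable (at z)"
    by (auto simp: differentiable_def)
qed

end


subsection \<open>Extension of coordinate fields\<close>

context smooth_atlas
begin

section \<open>The manifold topology seen through charts\<close>

lemma openin_chart_vimage:
  "c \<in> A \<Longrightarrow> open S \<Longrightarrow> openin (manifold_topology A) (fst c \<inter> snd c -` S)"
  unfolding manifold_topology_def by (rule topology_generated_by_Basis) blast

lemma Union_chart_vimages: "\<Union> {fst c \<inter> snd c -` S |c S. c \<in> A \<and> open S} = manifold_carrier A"
proof (intro equalityI subsetI)
  fix q assume "q \<in> manifold_carrier A"
  then obtain c where "c \<in> A" "q \<in> fst c \<inter> snd c -` UNIV" by (auto simp: manifold_carrier_def)
  then show "q \<in> \<Union> {fst c \<inter> snd c -` S |c S. c \<in> A \<and> open S}" using open_UNIV by blast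
qed (force simp: manifold_carrier_def)

lemma topspace_manifold_topology: "topspace (manifold_topology A) = manifold_carrier A"
  by (simp only: manifold_topology_def topology_generated_by_topspace Union_chart_vimages)

text \<open>Makes the image in the manifold of a closed coordinate ball compact; the support of a
  bump function lies in such an image.\<close>

lemma continuous_map_chart_inv:
  assumes c: "c \<in> A"
  shows "continuous_map (top_of_set (snd c ` fst c)) (manifold_topology A) (chart_inv c)"
  unfolding manifold_topology_def
proof (rule continuous_on_generated_topo)
  fix U assume "U \<in> {fst c \<inter> snd c -` S |c S. c \<in> A \<and> open S}"
  then obtain d S where d: "U = fst d \<inter> snd d -` S" "d \<in> A" "open S" by auto
  have "chart_inv c -` U \<inter> topspace (top_of_set (snd c ` fst c)) =
      {y \<in> snd c ` (fst c \<inter> fst d). snd d (chart_inv c y) \<in> S}"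
    using c by (auto simp: d chart_inv_chart)
  moreover have "openin (top_of_set (snd c ` fst c)) \<dots>"
    by (rule open_openin_trans[OF open_chart_image[OF c] open_transition_vimage[OF c d(2,3)]]) auto
  ultimately show "openin (top_of_set (snd c ` fst c))
      (chart_inv c -` U \<inter> topspace (top_of_set (snd c ` fst c)))" by simp
next
  show "chart_inv c ` topspace (top_of_set (snd c ` fst c)) \<subseteq> \<Union> {fst c \<inter> snd c -` S |c S. c \<in> A \<and> open S}"
    using c unfolding Union_chart_vimages by (auto simp: chart_inv_chart manifold_carrier_def)
qed

text \<open>Turns neighbourhoods in the manifold into open coordinate sets, on which smoothness and
  derivatives can be tested.\<close>

lemma open_chart_image_openin:
  assumes c: "c \<in> A" and V: "openin (manifold_topology A) V"
  shows "open (snd c ` (fst c \<inter> V))"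
proof -
  have "openin (top_of_set (snd c ` fst c)) {y \<in> snd c ` fst c. chart_inv c y \<in> V}"
    using openin_continuous_map_preimage[OF continuous_map_chart_inv[OF c] V] by simp
  moreover have "{y \<in> snd c ` fst c. chart_inv c y \<in> V} = snd c ` (fst c \<inter> V)"
    using c by (auto simp: chart_inv_chart)
  ultimately show ?thesis
    using open_chart_image[OF c] by (simp add: openin_open_eq)
qed

lemma tangent_space_zero: "(p, \<lambda>_. 0) \<in> tangent_space A p"
  by (rule tangent_spaceI)
    (simp_all add: linear_0[OF has_derivative_linear[OF transition_has_derivative]])

text \<open>The coordinate fields, multiplied by a bump function supported in the chart, extend by zero;
  that the support is closed in the manifold is where the Hausdorff property enters.\<close>

lemma coord_vec_extension:
  assumes c: "c \<in> A" and p: "p \<in> fst c"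
  obtains X V where "X \<in> vector_fields A" "openin (manifold_topology A) V" "p \<in> V" "V \<subseteq> fst c"
    "\<And>q. q \<in> V \<Longrightarrow> X q = coord_vec A c q e"
proof -
  obtain \<epsilon> where \<epsilon>: "\<epsilon> > 0" "cball (snd c p) \<epsilon> \<subseteq> snd c ` fst c"
    using open_chart_image[OF c] p by (meson image_eqI open_contains_cball)
  obtain h :: "'e \<Rightarrow> real" where h: "smooth_on UNIV h"
    "\<And>x. x \<in> ball (snd c p) (\<epsilon> / 2) \<Longrightarrow> h x = 1" "\<And>x. x \<notin> cball (snd c p) \<epsilon> \<Longrightarrow> h x = 0"
    using smooth_bump_exists[of "\<epsilon> / 2" \<epsilon>] \<epsilon>(1) by auto
  define K where "K = chart_inv c ` cball (snd c p) \<epsilon>"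
  have "compactin (manifold_topology A) K"
    unfolding K_def
    by (rule image_compactin[OF _ continuous_map_chart_inv[OF c]])
      (simp add: compactin_subtopology \<epsilon>(2))
  then have "closedin (manifold_topology A) K"
    using smooth by (intro compactin_imp_closedin) (simp_all add: smooth_manifold_def)
  then have K: "openin (manifold_topology A) (manifold_carrier A - K)"
    by (simp add: closedin_def topspace_manifold_topology)
  define X where "X = (\<lambda>q\<in>manifold_carrier A.
    if q \<in> fst c then coord_vec A c q (h (snd c q) *\<^sub>R e) else (q, \<lambda>_. 0))"
  \<comment> \<open>On the half-radius ball \<open>h\<close> is 1, so there the cut-off field is the
    coordinate field itself.\<close>
  define V where "V = fst c \<inter> snd c -` ball (snd c p) (\<epsilon> / 2)"
  have in_carrier: "q \<in> manifold_carrier A" if "d \<in> A" "q \<in> fst d" for d q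
    using that by (auto simp: manifold_carrier_def)
  have "smooth_on (snd d ` fst d) (\<lambda>y. snd (X (chart_inv d y)) d)" if d: "d \<in> A" for d
  proof (rule smooth_on_locally)
    fix y assume "y \<in> snd d ` fst d"
    then obtain q where q: "q \<in> fst d" "y = snd d q" by auto
    show "\<exists>U. open U \<and> y \<in> U \<and> smooth_on U (\<lambda>y. snd (X (chart_inv d y)) d)"
    proof (cases "q \<in> fst c")
      case True
      let ?U = "snd d ` (fst d \<inter> fst c)" and ?T = "snd c ` (fst c \<inter> fst d)"
      let ?G = "\<lambda>x. h x *\<^sub>R transition_derivative c d x e"
      have U: "open ?U" and T: "open ?T" using c d by (auto simp: open_overlap)
      have G: "smooth_on ?T ?G"
        using h(1) T smooth_on_subset
        by (intro bounded_bilinear.smooth_on[OF bounded_bilinear_scaleR] smooth_on_frechet_derivative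
            smooth_transition c d) auto
      have "smooth_on ?U (\<lambda>y. ?G ((snd c \<circ> chart_inv d) y))"
        by (rule smooth_on_compose[OF U T _ smooth_transition[OF d c] G])
          (auto simp: chart_inv_chart d)
      then have "smooth_on ?U (\<lambda>y. snd (X (chart_inv d y)) d)"
      proof (rule smooth_on_cong[OF U, rotated])
        fix y assume "y \<in> ?U"
        then obtain r where r: "r \<in> fst d" "r \<in> fst c" "y = snd d r" by auto
        with c d have cr: "c \<in> charts_at A r" "d \<in> charts_at A r" by (auto simp: charts_at_def)
        have "linear (transition_derivative c d (snd c r))"
          by (rule has_derivative_linear[OF transition_has_derivative[OF cr]])
        then show "?G ((snd c \<circ> chart_inv d) y) = snd (X (chart_inv d y)) d"
          using r cr c d in_carrier[OF d r(1)]
          by (simp add: chart_inv_chart X_def coord_vec_def linear_scale)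
      qed
      then show ?thesis using U q True by blast
    next
      case False
      \<comment> \<open>A point outside the domain of \<open>c\<close> is not in \<open>K\<close>.
        In the complement of \<open>K\<close> a point lies either outside the domain of
        \<open>c\<close>, where the field is 0 by definition, or outside the ball, where
        \<open>h\<close> is 0.\<close>
      let ?U = "snd d ` (fst d \<inter> (manifold_carrier A - K))"
      have U: "open ?U" by (rule open_chart_image_openin[OF d K])
      have "smooth_on ?U (\<lambda>y. snd (X (chart_inv d y)) d)"
      proof (rule smooth_on_cong[OF U _ smooth_on_const[OF U]])
        fix y assume "y \<in> ?U"
        then obtain r where r: "r \<in> fst d" "r \<notin> K" "y = snd d r" by auto
        have "X r = coord_vec A c r 0" if "r \<in> fst c"
        proof -
          have "snd c r \<notin> cball (snd c p) \<epsilon>"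
            using r(2) chart_inv_chart[OF c that] unfolding K_def by (metis image_eqI)
          then show ?thesis using that in_carrier[OF c that] by (simp add: X_def h(3))
        qed
        moreover have "snd (coord_vec A c r 0) d = 0" if "r \<in> fst c"
          using that c d r
          by (simp add: coord_vec_def charts_at_def
              linear_0[OF has_derivative_linear[OF transition_has_derivative]])
        ultimately show "0 = snd (X (chart_inv d y)) d"
          using r d in_carrier[OF d r(1)] by (cases "r \<in> fst c") (auto simp: chart_inv_chart X_def)
      qed
      moreover have "q \<notin> K"
        using False chart_inv_in[OF subsetD[OF \<epsilon>(2)]] unfolding K_def by (metis imageE)
      then have "y \<in> ?U" using q in_carrier[OF d q(1)] by simp
      ultimately show ?thesis using U by (intro exI[of _ ?U]) simp
    qed
  qed
  moreover have "X \<in> (\<Pi>\<^sub>E q\<in>manifold_carrier A. tangent_space A q)"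
    using c by (auto simp: X_def tangent_space_zero charts_at_def intro!: coord_vec_in_tangent_space)
  ultimately have "X \<in> vector_fields A" by (simp add: vector_fields_def)
  moreover have "openin (manifold_topology A) V"
    unfolding V_def by (rule openin_chart_vimage[OF c open_ball])
  moreover have "X q = coord_vec A c q e" if "q \<in> V" for q
    using that in_carrier[OF c] h(2) by (auto simp: V_def X_def)
  ultimately show ?thesis using p \<epsilon>(1) by (intro that[of X V]) (auto simp: V_def)
qed

end


subsection \<open>Tangent maps on the frame bundle\<close>

text \<open>The usual expansion of an inverse near the identity. A single lower bound,
  \<open>norm w \<le> 2 * norm (m *v w)\<close> for \<open>m\<close> close to \<open>mat 1\<close>,
  gives both invertibility and control of the remainder.\<close>

lemma has_derivative_matrix_inv_mult_vec:
  fixes e :: "real^'n"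
  shows "((\<lambda>m. matrix_inv m *v e) has_derivative (\<lambda>N. - (N *v e))) (at (mat 1))"
proof -
  obtain K where K: "K > 0" "\<And>(N :: real^'n^'n) w. norm (N *v w) \<le> norm N * norm w * K"
    using bounded_bilinear.pos_bounded[OF bounded_bilinear_matrix_vector_mult] by blast
  \<comment> \<open>Radius \<open>1 / (2 * K)\<close> lets \<open>m - mat 1\<close> change a vector
    by at most half its norm.\<close>
  have low: "norm w \<le> 2 * norm (m *v w)" if "dist m (mat 1) < 1 / (2 * K)" for m :: "real^'n^'n" and w
  proof -
    have "norm ((m - mat 1) *v w) \<le> norm (m - mat 1) * norm w * K" by (rule K(2))
    also have "\<dots> = (norm (m - mat 1) * K) * norm w" by simp
    also have "\<dots> \<le> 1 / 2 * norm w"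
      using that K(1) by (intro mult_right_mono) (auto simp: dist_norm field_simps)
    finally have "norm (m *v w - w) \<le> norm w / 2" by (simp add: matrix_vector_mult_diff_rdistrib)
    then show ?thesis using norm_triangle_ineq2[of w "m *v w"] norm_minus_commute[of w "m *v w"] by linarith
  qed
  have inv: "invertible m" if "dist m (mat 1) < 1 / (2 * K)" for m :: "real^'n^'n"
  proof -
    have "inj ((*v) m)"
    proof (rule injI)
      fix x y assume "m *v x = m *v y"
      then show "x = y" using low[OF that, of "x - y"] by (simp add: matrix_vector_mult_diff_distrib)
    qed
    then show ?thesis
      by (simp add: matrix_left_invertible_injective[symmetric] invertible_left_inverse)
  qed
  have one: "matrix_inv (mat 1 :: real^'n^'n) = mat 1"
    using matrix_inv_left[OF inv[of "mat 1"]] K(1) by simp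
  show ?thesis
  proof (rule has_derivativeI_sandwich[where e = "1 / (2 * K)"
        and H = "\<lambda>m. 2 * K\<^sup>2 * norm e * norm (m - mat 1)"])
    show "bounded_linear (\<lambda>N :: real^'n^'n. - (N *v e))"
      by (intro bounded_linear_minus bounded_bilinear.bounded_linear_left[OF
          bounded_bilinear_matrix_vector_mult])
    have "((\<lambda>m :: real^'n^'n. 2 * K\<^sup>2 * norm e * norm (m - mat 1)) \<longlongrightarrow>
        2 * K\<^sup>2 * norm e * norm (mat 1 - mat 1 :: real^'n^'n)) (at (mat 1))"
      by (intro tendsto_intros)
    then show "((\<lambda>m :: real^'n^'n. 2 * K\<^sup>2 * norm e * norm (m - mat 1)) \<longlongrightarrow> 0) (at (mat 1))"
      by simp
    fix m :: "real^'n^'n" assume m: "m \<noteq> mat 1" "dist m (mat 1) < 1 / (2 * K)"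
    define D where "D = m - mat 1"
    \<comment> \<open>The remainder of the linear approximation. Multiplication by \<open>m\<close>
      removes the inverse and leaves \<open>D *v (D *v e)\<close>, quadratic in \<open>D\<close>;
      dividing the resulting bound by \<open>norm D\<close> gives the function \<open>H\<close>
      above.\<close>
    define r where "r = matrix_inv m *v e - matrix_inv (mat 1) *v e - (- (D *v e))"
    have D: "D *v w = m *v w - w" for w by (simp add: D_def matrix_vector_mult_diff_rdistrib)
    have x: "m *v (matrix_inv m *v e) = e"
      using matrix_inv_right[OF inv[OF m(2)]] by (simp add: matrix_vector_mul_assoc)
    have "m *v r = e - m *v e + (m *v (m *v e) - m *v e)"
      by (simp only: r_def one D matrix_vector_mult_diff_distrib matrix_vector_right_distrib
          matrix_vector_mul_lid diff_minus_eq_add x)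
    also have "\<dots> = D *v (D *v e)"
      by (simp add: D matrix_vector_mult_diff_distrib)
    finally have "m *v r = D *v (D *v e)" .
    then have "norm r \<le> 2 * norm (D *v (D *v e))" using low[OF m(2), of r] by simp
    also have "\<dots> \<le> 2 * (norm D * (norm D * norm e * K) * K)"
      using K(1) K(2)[of D "D *v e"] K(2)[of D e]
      by (intro mult_left_mono order_trans[OF K(2)] mult_right_mono mult_nonneg_nonneg) auto
    also have "\<dots> = (2 * K\<^sup>2 * norm e * norm D) * norm D" by (simp add: power2_eq_square)
    finally show "norm (matrix_inv m *v e - matrix_inv (mat 1) *v e - (- ((m - mat 1) *v e))) /
        norm (m - mat 1) \<le> 2 * K\<^sup>2 * norm e * norm (m - mat 1)"
      using m(1) by (simp add: r_def D_def divide_le_eq)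
  qed (use K(1) in auto)
qed

lemma frame_act_chart_frame: "frame_act (chart_frame A c p m) g = chart_frame A c p (m ** g)"
  by (simp add: frame_act_def chart_frame_def matrix_vector_mul_assoc)

sublocale smooth_atlas \<subseteq> tangent: C1_atlas "tangent_atlas A"
  by (rule C1_atlas_tangent_atlas)

sublocale smooth_frame_atlas \<subseteq> frame: C1_atlas "frame_atlas A"
  by (rule C1_atlas_frame_atlas)

context smooth_frame_atlas
begin

lemma frame_chart_at:
  assumes "c \<in> charts_at A p" "invertible m"
  shows "frame_chart A c \<in> charts_at (frame_atlas A) (chart_frame A c p m)"
  using chart_frame_in_frame_chart[OF assms charts_atD(2)[OF assms(1)]] charts_atD(1)[OF assms(1)]
  by (simp add: charts_at_def frame_atlas_def)

lemma tangent_chart_at: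
  assumes "c \<in> charts_at A p"
  shows "tangent_chart A c \<in> charts_at (tangent_atlas A) (coord_vec A c p v)"
  using tangent_chart_coord_vec(1)[OF assms] charts_atD(1)[OF assms]
  by (simp add: charts_at_def tangent_atlas_def)

lemma frame_chart_range:
  "c \<in> A \<Longrightarrow> snd (frame_chart A c) ` fst (frame_chart A c) = (snd c ` fst c) \<times> {m. invertible m}"
  using frame_chart_image[of c c] by simp

lemma open_frame_chart_range: "c \<in> A \<Longrightarrow> open ((snd c ` fst c) \<times> {m :: real^'n^'n. invertible m})"
  by (simp add: open_Times open_chart_image open_invertible)

text \<open>The common pattern of the projection, the right action and the association map: in the
  induced charts each is a linear \<open>G\<close>, which is its own derivative.\<close>

lemma tangent_map_from_frames:
  assumes B: "C1_atlas B" and c: "c \<in> charts_at A p" and m: "invertible m"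
    and w: "w \<in> tangent_space (frame_atlas A) (chart_frame A c p m)"
    and d: "d \<in> B" "\<And>q m'. c \<in> charts_at A q \<Longrightarrow> invertible m' \<Longrightarrow> f (chart_frame A c q m') \<in> fst d"
    and G: "\<And>q m'. c \<in> charts_at A q \<Longrightarrow> invertible m' \<Longrightarrow>
      snd d (f (chart_frame A c q m')) = G (snd c q, m')"
    and G': "bounded_linear G"
  shows "tangent_map (frame_atlas A) B f w =
    coord_vec B d (f (chart_frame A c p m)) (G (snd w (frame_chart A c)))"
proof (rule tangent_map_eq_coord_vec[OF C1_atlas_frame_atlas B frame_chart_at[OF c m] _ w])
  let ?W = "(snd c ` fst c) \<times> {m :: real^'n^'n. invertible m}"
  have cA: "c \<in> A" using c by (rule charts_atD)
  have inv: "chart_inv (frame_chart A c) (x, m') = chart_frame A c (chart_inv c x) m'"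
    "c \<in> charts_at A (chart_inv c x)" "snd c (chart_inv c x) = x"
    if "(x, m') \<in> ?W" for x m'
    using that cA by (auto simp: chart_inv_frame_chart charts_at_chart_inv chart_chart_inv)
  show W: "open ?W" by (rule open_frame_chart_range[OF cA])
  show p: "snd (frame_chart A c) (chart_frame A c p m) \<in> ?W"
    using c m charts_atD by (auto simp: frame_chart_chart_frame[OF c])
  show "?W \<subseteq> snd (frame_chart A c) ` fst (frame_chart A c)" using cA by (simp add: frame_chart_range)
  show "d \<in> charts_at B (f (chart_frame A c p m))" using d c m by (simp add: charts_at_def)
  show "f (chart_inv (frame_chart A c) y) \<in> fst d" if "y \<in> ?W" for y
    using that inv[of "fst y" "snd y"] d(2) by (cases y) auto
  show "((snd d \<circ> f \<circ> chart_inv (frame_chart A c)) has_derivative G)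
      (at (snd (frame_chart A c) (chart_frame A c p m)))"
  proof (rule has_derivative_transform_within_open[OF bounded_linear_imp_has_derivative[OF G'] W p])
    fix y assume "y \<in> ?W"
    then show "G y = (snd d \<circ> f \<circ> chart_inv (frame_chart A c)) y"
      using inv[of "fst y" "snd y"] G by (cases y) auto
  qed
qed

lemma tangent_map_frame_proj:
  assumes c: "c \<in> charts_at A p" and m: "invertible m"
    and w: "w \<in> tangent_space (frame_atlas A) (chart_frame A c p m)"
  shows "tangent_map (frame_atlas A) A frame_proj w = coord_vec A c p (fst (snd w (frame_chart A c)))"
proof -
  have "tangent_map (frame_atlas A) A frame_proj w =
      coord_vec A c (frame_proj (chart_frame A c p m)) (fst (snd w (frame_chart A c)))"
    by (rule tangent_map_from_frames[OF C1_atlas_axioms c m w, where G = fst])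
      (use c in \<open>auto simp: frame_proj_chart_frame charts_at_def bounded_linear_fst\<close>)
  then show ?thesis by (simp add: frame_proj_chart_frame)
qed

lemma tangent_map_frame_act:
  assumes c: "c \<in> charts_at A p" and m: "invertible m" and g: "invertible g"
    and w: "w \<in> tangent_space (frame_atlas A) (chart_frame A c p m)"
  shows "tangent_map (frame_atlas A) (frame_atlas A) (\<lambda>u. frame_act u g) w =
    coord_vec (frame_atlas A) (frame_chart A c) (chart_frame A c p (m ** g))
      (fst (snd w (frame_chart A c)), snd (snd w (frame_chart A c)) ** g)"
proof -
  have "tangent_map (frame_atlas A) (frame_atlas A) (\<lambda>u. frame_act u g) w =
    coord_vec (frame_atlas A) (frame_chart A c) (frame_act (chart_frame A c p m) g)
      ((\<lambda>z. (fst z, snd z ** g)) (snd w (frame_chart A c)))"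
  proof (rule tangent_map_from_frames[OF C1_atlas_frame_atlas c m w])
    show "frame_chart A c \<in> frame_atlas A" using c by (simp add: frame_atlas_def charts_at_def)
    show "bounded_linear (\<lambda>z :: (real^'n) \<times> (real^'n^'n). (fst z, snd z ** g))"
      by (intro bounded_linear_Pair bounded_linear_fst bounded_linear_compose[OF
          bounded_bilinear.bounded_linear_left[OF bounded_bilinear_matrix_matrix_mult]]
          bounded_linear_snd)
  qed (use g in \<open>auto simp: frame_act_chart_frame frame_chart_chart_frame invertible_mult charts_atD
      intro!: chart_frame_in_frame_chart\<close>)
  then show ?thesis by (simp add: frame_act_chart_frame)
qed

lemma tangent_map_association_map:
  assumes c: "c \<in> charts_at A p" and m: "invertible m"
    and w: "w \<in> tangent_space (frame_atlas A) (chart_frame A c p m)"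
  shows "tangent_map (frame_atlas A) (tangent_atlas A) (association_map \<xi>) w =
    coord_vec (tangent_atlas A) (tangent_chart A c) (chart_frame A c p m \<xi>)
      (fst (snd w (frame_chart A c)), snd (snd w (frame_chart A c)) *v \<xi>)"
proof -
  have "tangent_map (frame_atlas A) (tangent_atlas A) (association_map \<xi>) w =
    coord_vec (tangent_atlas A) (tangent_chart A c) (association_map \<xi> (chart_frame A c p m))
      ((\<lambda>z. (fst z, snd z *v \<xi>)) (snd w (frame_chart A c)))"
  proof (rule tangent_map_from_frames[OF C1_atlas_tangent_atlas c m w])
    show "tangent_chart A c \<in> tangent_atlas A" using c by (simp add: tangent_atlas_def charts_at_def)
    show "bounded_linear (\<lambda>z :: (real^'n) \<times> (real^'n^'n). (fst z, snd z *v \<xi>))"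
      by (intro bounded_linear_Pair bounded_linear_fst bounded_linear_compose[OF
          bounded_bilinear.bounded_linear_left[OF bounded_bilinear_matrix_vector_mult]]
          bounded_linear_snd)
  qed (auto simp: association_map_def chart_frame_def tangent_chart_coord_vec)
  then show ?thesis by (simp add: association_map_def)
qed

text \<open>In the chart, acting by \<open>g\<close> is left multiplication of \<open>g\<close> by
  \<open>m\<close> over a fixed base point: no base component, and a matrix part linear in
  \<open>g\<close>.\<close>

lemma fundamental_vector_chart_frame:
  assumes c: "c \<in> charts_at A p" and m: "invertible m"
  shows "fundamental_vector A a (chart_frame A c p m) =
    coord_vec (frame_atlas A) (frame_chart A c) (chart_frame A c p m) (0, m ** a)"
proof -
  let ?u = "chart_frame A c p m" and ?FC = "frame_chart A c"
  have "frechet_derivative (\<lambda>g. snd d (frame_act ?u g)) (at (mat 1)) a =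
      transition_derivative ?FC d (snd ?FC ?u) (0, m ** a)"
    if d: "d \<in> charts_at (frame_atlas A) ?u" for d
  proof -
    let ?L = "\<lambda>g. (snd c p, m ** g)"
    have 1: "(?L has_derivative (\<lambda>g. (0, m ** g))) (at (mat 1))"
      by (intro has_derivative_Pair has_derivative_const bounded_linear_imp_has_derivative
          bounded_bilinear.bounded_linear_right[OF bounded_bilinear_matrix_matrix_mult])
    have eq: "?L (mat 1) = snd ?FC ?u" by (simp add: frame_chart_chart_frame[OF c])
    have "((snd d \<circ> chart_inv ?FC) \<circ> ?L has_derivative
        transition_derivative ?FC d (snd ?FC ?u) \<circ> (\<lambda>g. (0, m ** g))) (at (mat 1))"
      by (rule diff_chain_at[OF 1])
        (simp only: eq frame.transition_has_derivative[OF frame_chart_at[OF c m] d])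
    then have "((\<lambda>g. snd d (frame_act ?u g)) has_derivative
        transition_derivative ?FC d (snd ?FC ?u) \<circ> (\<lambda>g. (0, m ** g))) (at (mat 1))"
    \<comment> \<open>\<open>chart_inv\<close> recovers the frame \<open>m ** g\<close> only for
      invertible \<open>g\<close>; these form a neighbourhood of \<open>mat 1\<close>.\<close>
    proof (rule has_derivative_transform_within_open[OF _ open_invertible])
      fix g :: "real^'n^'n" assume "g \<in> {m. invertible m}"
      then have "invertible (m ** g)" using m by (simp add: invertible_mult)
      then show "(snd d \<circ> chart_inv ?FC \<circ> ?L) g = snd d (frame_act ?u g)"
        using c by (simp add: frame_act_chart_frame chart_inv_frame_chart charts_atD chart_inv_chart)
    qed (simp add: invertible_def)
    from frechet_derivative_eq[OF this] show ?thesis by simp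
  qed
  then show ?thesis
    by (intro prod_eqI ext) (simp_all add: fundamental_vector_def coord_vec_def)
qed

end


subsection \<open>Horizontal vectors and the field Z\<close>

locale connection_form = smooth_frame_atlas A for A :: "('m, real^'n) atlas" +
  fixes \<omega> :: "('m, 'n) frame_tvec \<Rightarrow> real^'n^'n"
  assumes connection: "linear_connection A \<omega>"
begin

abbreviation frame_vec ::
    "('m, real^'n) chart \<Rightarrow> 'm \<Rightarrow> real^'n^'n \<Rightarrow> (real^'n) \<times> (real^'n^'n) \<Rightarrow> ('m, 'n) frame_tvec" where
  "frame_vec c p m z \<equiv> coord_vec (frame_atlas A) (frame_chart A c) (chart_frame A c p m) z"

text \<open>The local connection form: the pullback of \<open>\<omega>\<close> along the coordinate frame of \<open>c\<close>.\<close>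

definition local_form :: "('m, real^'n) chart \<Rightarrow> 'm \<Rightarrow> real^'n \<Rightarrow> real^'n^'n" where
  "local_form c p v = \<omega> (frame_vec c p (mat 1) (v, 0))"

lemma invertible_one: "invertible (mat 1 :: real^'n^'n)"
  by (auto simp: invertible_def)

lemma frame_in_bundle:
  assumes "c \<in> charts_at A p" "invertible m"
  shows "chart_frame A c p m \<in> frame_bundle A"
  using frames_at_in_bundle chart_frame_in_frames_at assms by blast

lemma frame_vec_in:
  assumes "c \<in> charts_at A p" "invertible m"
  shows "frame_vec c p m z \<in> tangent_space (frame_atlas A) (chart_frame A c p m)"
  by (rule frame.coord_vec_in_tangent_space[OF frame_chart_at[OF assms]])

lemma omega_add:
  assumes "u \<in> frame_bundle A" "w \<in> tangent_space (frame_atlas A) u"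
    "w' \<in> tangent_space (frame_atlas A) u"
  shows "\<omega> (tv_add w w') = \<omega> w + \<omega> w'"
  using connection assms unfolding linear_connection_def by blast

lemma omega_scale:
  assumes "u \<in> frame_bundle A" "w \<in> tangent_space (frame_atlas A) u"
  shows "\<omega> (tv_scale r w) = r *\<^sub>R \<omega> w"
  using connection assms unfolding linear_connection_def by blast

lemma omega_fundamental:
  assumes "u \<in> frame_bundle A"
  shows "\<omega> (fundamental_vector A a u) = a"
  using connection assms unfolding linear_connection_def by blast

lemma omega_frame_act:
  assumes "u \<in> frame_bundle A" "w \<in> tangent_space (frame_atlas A) u" "invertible g"
  shows "\<omega> (tangent_map (frame_atlas A) (frame_atlas A) (\<lambda>u. frame_act u g) w) =
    matrix_inv g ** \<omega> w ** g"
  using connection assms unfolding linear_connection_def by blast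

lemma linear_omega_frame_vec:
  assumes "c \<in> charts_at A p" "invertible m"
  shows "linear (\<lambda>z. \<omega> (frame_vec c p m z))"
proof (rule linearI)
  note * = frame_in_bundle[OF assms] frame_vec_in[OF assms]
  show "\<omega> (frame_vec c p m (a + b)) = \<omega> (frame_vec c p m a) + \<omega> (frame_vec c p m b)" for a b
    using omega_add[OF * *(2)] by (simp add: frame.tv_add_coord_vec[OF frame_chart_at[OF assms]])
  show "\<omega> (frame_vec c p m (r *\<^sub>R a)) = r *\<^sub>R \<omega> (frame_vec c p m a)" for r a
    using omega_scale[OF *] by (simp add: frame.tv_scale_coord_vec[OF frame_chart_at[OF assms]])
qed

lemma linear_local_form:
  assumes "c \<in> charts_at A p"
  shows "linear (local_form c p)"
proof -
  have "linear (\<lambda>v :: real^'n. (v, 0 :: real^'n^'n))" by (auto intro!: linearI)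
  from linear_compose[OF this linear_omega_frame_vec[OF assms invertible_one]]
  show ?thesis by (simp add: local_form_def[abs_def] o_def)
qed

text \<open>Every vertical vector at an invertible \<open>m\<close> has this form, with
  \<open>a\<close> being \<open>matrix_inv m\<close> times its matrix part. Hence
  \<open>\<omega>\<close> is injective on vertical vectors, the source of uniqueness of horizontal
  lifts.\<close>

lemma omega_vertical:
  assumes "c \<in> charts_at A p" "invertible m"
  shows "\<omega> (frame_vec c p m (0, m ** a)) = a"
  using omega_fundamental[OF frame_in_bundle[OF assms]]
  by (simp add: fundamental_vector_chart_frame[OF assms])

text \<open>A horizontal vector at the coordinate frame has matrix part \<open>- \<theta> v\<close>, with \<open>\<theta>\<close> the local
  form; the right action of \<open>m\<close> carries it to the horizontal vector at any other frame.\<close>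

lemma omega_horizontal:
  assumes c: "c \<in> charts_at A p" and m: "invertible m"
  shows "\<omega> (frame_vec c p m (v, - (local_form c p v ** m))) = 0"
proof -
  let ?\<theta> = "local_form c p v" and ?w = "frame_vec c p (mat 1) (v, - local_form c p v)"
  have "\<omega> ?w = \<omega> (frame_vec c p (mat 1) (v, 0)) + \<omega> (frame_vec c p (mat 1) (0, mat 1 ** (- ?\<theta>)))"
    using linear_add[OF linear_omega_frame_vec[OF c invertible_one], of "(v, 0)" "(0, - ?\<theta>)"] by simp
  then have "\<omega> ?w = 0"
    unfolding omega_vertical[OF c invertible_one] by (simp add: local_form_def)
  moreover have "\<omega> (frame_vec c p (mat 1 ** m)
      (fst (snd ?w (frame_chart A c)), snd (snd ?w (frame_chart A c)) ** m)) = matrix_inv m ** \<omega> ?w ** m"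
    using omega_frame_act[OF frame_in_bundle[OF c invertible_one] frame_vec_in[OF c invertible_one] m,
        of "(v, - ?\<theta>)"]
    by (simp only: tangent_map_frame_act[OF c invertible_one m frame_vec_in[OF c invertible_one]])
  moreover have "- ?\<theta> ** m = - (?\<theta> ** m)"
    using bounded_bilinear.minus_left[OF bounded_bilinear_matrix_matrix_mult] by blast
  ultimately show ?thesis
    by (simp add: frame.coord_vec_same[OF frame_chart_at[OF c invertible_one]]
        bounded_bilinear.zero_left[OF bounded_bilinear_matrix_matrix_mult]
        bounded_bilinear.zero_right[OF bounded_bilinear_matrix_matrix_mult])
qed

text \<open>Existence comes from \<open>omega_horizontal\<close>. For uniqueness, two lifts of the
  same vector differ by a vertical vector, and this is 0 because \<open>\<omega>\<close> kills
  it.\<close>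

lemma horizontal_vector_eq:
  assumes c: "c \<in> charts_at A p" and m: "invertible m" and v: "v \<in> tangent_space A p"
  shows "horizontal_vector A \<omega> (chart_frame A c p m) v =
    frame_vec c p m (snd v c, - (local_form c p (snd v c) ** m))"
  unfolding horizontal_vector_def
proof (rule the_equality)
  let ?u = "chart_frame A c p m" and ?FC = "frame_chart A c"
  let ?w = "frame_vec c p m (snd v c, - (local_form c p (snd v c) ** m))"
  note FC = frame_chart_at[OF c m]
  show "?w \<in> tangent_space (frame_atlas A) ?u \<and> \<omega> ?w = 0 \<and>
      tangent_map (frame_atlas A) A frame_proj ?w = v"
    using frame_vec_in[OF c m] omega_horizontal[OF c m] tangent_space_eq_coord_vec[OF v c]
    by (simp add: tangent_map_frame_proj[OF c m] frame.coord_vec_same[OF FC])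
  fix w assume w: "w \<in> tangent_space (frame_atlas A) ?u \<and> \<omega> w = 0 \<and>
      tangent_map (frame_atlas A) A frame_proj w = v"
  obtain v' N where N: "snd w ?FC = (v', N)" by fastforce
  have w_eq: "w = frame_vec c p m (v', N)"
    using frame.tangent_space_eq_coord_vec[OF _ FC, of w] w N by simp
  have "coord_vec A c p v' = v"
    using w N tangent_map_frame_proj[OF c m, of w] by simp
  then have v': "v' = snd v c" using coord_vec_same[OF c] by metis
  \<comment> \<open>The generator of the vertical difference between \<open>w\<close> and the
    claimed lift; \<open>\<omega>\<close> returns exactly this matrix.\<close>
  let ?a = "matrix_inv m ** (N + local_form c p v' ** m)"
  have "m ** ?a = N + local_form c p v' ** m"
    by (simp add: matrix_mul_assoc matrix_inv_right[OF m])
  then have "?a = \<omega> (frame_vec c p m (0, N + local_form c p v' ** m))"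
    using omega_vertical[OF c m, of ?a] by simp
  also have "\<dots> = \<omega> (frame_vec c p m (v', N)) -
      \<omega> (frame_vec c p m (v', - (local_form c p v' ** m)))"
    using linear_diff[OF linear_omega_frame_vec[OF c m], of "(v', N)" "(v', - (local_form c p v' ** m))"]
    by simp
  also have "\<dots> = 0" using w w_eq omega_horizontal[OF c m] by simp
  finally have "N + local_form c p v' ** m = 0"
    using \<open>m ** ?a = _\<close> bounded_bilinear.zero_right[OF bounded_bilinear_matrix_matrix_mult] by metis
  then have "N = - (local_form c p v' ** m)" by (simp add: eq_neg_iff_add_eq_0)
  then show "w = ?w" by (simp add: w_eq v')
qed

lemma frame_value_coords:
  assumes c: "c \<in> charts_at A p" and "chart_frame A c p m \<xi> = v"
  shows "snd v c = m *v \<xi>"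
  using assms(2) coord_vec_same[OF c] by (auto simp: chart_frame_def)

text \<open>Stated as an equivalence, this yields existence, uniqueness and the value of the
  description in \<open>Z_field\<close> at once.\<close>

lemma is_Z_value_iff:
  assumes c: "c \<in> A" "fst v \<in> fst c" and v: "v \<in> tangent_bundle A"
  shows "is_Z_value A \<omega> v w \<longleftrightarrow> w = coord_vec (tangent_atlas A) (tangent_chart A c) v
    (snd v c, - (local_form c (fst v) (snd v c) *v snd v c))" (is "_ \<longleftrightarrow> w = ?z")
proof -
  let ?p = "fst v"
  have c: "c \<in> charts_at A ?p" using c by (simp add: charts_at_def)
  have vT: "v \<in> tangent_space A ?p" by (rule tangent_bundleD[OF v])
  have val: "tangent_map (frame_atlas A) (tangent_atlas A) (association_map \<xi>)
      (standard_horizontal A \<omega> \<xi> (chart_frame A c ?p m)) = ?z"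
    if m: "invertible m" and \<xi>: "chart_frame A c ?p m \<xi> = v" for m \<xi>
  proof -
    have "- (local_form c ?p (snd v c) ** m) *v \<xi> = - (local_form c ?p (snd v c) *v (m *v \<xi>))"
      by (simp add: matrix_vector_mul_assoc
          bounded_bilinear.minus_left[OF bounded_bilinear_matrix_vector_mult])
    then show ?thesis
      unfolding standard_horizontal_def \<xi> horizontal_vector_eq[OF c m vT]
        tangent_map_association_map[OF c m frame_vec_in[OF c m]]
        frame.coord_vec_same[OF frame_chart_at[OF c m]]
      using frame_value_coords[OF c \<xi>] by simp
  qed
  show ?thesis
  proof
    assume "is_Z_value A \<omega> v w"
    then obtain u \<xi> where u: "u \<in> frames_at A ?p" "u \<xi> = v"
      "w = tangent_map (frame_atlas A) (tangent_atlas A) (association_map \<xi>)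
        (standard_horizontal A \<omega> \<xi> u)" by (auto simp: is_Z_value_def)
    from frames_atE[OF c u(1)] val u(2,3) show "w = ?z" by metis
  next
    assume "w = ?z"
    \<comment> \<open>The coordinate frame applied to the coordinates of \<open>v\<close> witnesses
      that some pair of frame and vector represents \<open>v\<close>.\<close>
    moreover have \<xi>: "chart_frame A c ?p (mat 1) (snd v c) = v"
      using tangent_space_eq_coord_vec[OF vT c] by (simp add: chart_frame_def)
    ultimately show "is_Z_value A \<omega> v w"
      unfolding is_Z_value_def
      using val[OF invertible_one \<xi>] chart_frame_in_frames_at[OF c invertible_one] by metis
  qed
qed

lemma Z_field_eq:
  assumes "c \<in> A" "fst v \<in> fst c" "v \<in> tangent_bundle A"
  shows "Z_field A \<omega> v = coord_vec (tangent_atlas A) (tangent_chart A c) v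
    (snd v c, - (local_form c (fst v) (snd v c) *v snd v c))"
proof -
  have "(THE w. is_Z_value A \<omega> v w) = coord_vec (tangent_atlas A) (tangent_chart A c) v
      (snd v c, - (local_form c (fst v) (snd v c) *v snd v c))"
    by (rule the_equality) (simp_all add: is_Z_value_iff[OF assms])
  with assms(3) show ?thesis by (simp add: Z_field_def)
qed

section \<open>Smoothness and the second-order property of the field Z\<close>

lemma smooth_on_local_form:
  assumes c: "c \<in> A"
  shows "smooth_on (snd c ` fst c) (\<lambda>x. local_form c (chart_inv c x) e)"
proof -
  let ?FC = "frame_chart A c" and ?U = "snd c ` fst c"
  have U: "open ?U" by (rule open_chart_image[OF c])
  have "?FC \<in> frame_atlas A" using c by (simp add: frame_atlas_def)
  then have *: "smooth_on (?U \<times> {m. invertible m})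
      (\<lambda>y. \<omega> (coord_vec (frame_atlas A) ?FC (chart_inv ?FC y) (e, 0)))"
    using connection unfolding linear_connection_def frame_chart_range[OF c, symmetric] by blast
  \<comment> \<open>Restriction of the smoothness of \<open>\<omega>\<close> to the coordinate
    frames, the points \<open>(x, mat 1)\<close> of the frame chart.\<close>
  have "smooth_on ?U (\<lambda>x. \<omega> (coord_vec (frame_atlas A) ?FC (chart_inv ?FC (x, mat 1)) (e, 0)))"
    by (rule smooth_on_compose[OF U open_frame_chart_range[OF c] _
          smooth_on_Pair[OF U smooth_on_linear[OF bounded_linear_ident U] smooth_on_const[OF U]] *])
      (auto simp: invertible_one)
  then show ?thesis
    by (rule smooth_on_cong[OF U, rotated])
      (simp add: local_form_def chart_inv_frame_chart[OF c _ invertible_one])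
qed

lemma local_form_expansion:
  assumes "c \<in> charts_at A p"
  shows "local_form c p v = (\<Sum>j\<in>UNIV. v $ j *\<^sub>R local_form c p (axis j 1))"
proof -
  have "local_form c p v = local_form c p (\<Sum>j\<in>UNIV. v $ j *\<^sub>R axis j 1)"
    using basis_expansion[of v] by (simp add: scalar_mult_eq_scaleR)
  then show ?thesis
    by (simp add: linear_sum[OF linear_local_form[OF assms]]
        linear_scale[OF linear_local_form[OF assms]])
qed

lemma Z_field_in_vector_fields: "Z_field A \<omega> \<in> vector_fields (tangent_atlas A)"
proof -
  have carrier: "manifold_carrier (tangent_atlas A) = tangent_bundle A"
    using tangent_bundleD(2) by (force simp: manifold_carrier_def tangent_atlas_def tangent_chart_def)
  have "Z_field A \<omega> v \<in> tangent_space (tangent_atlas A) v" if v: "v \<in> tangent_bundle A" for v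
  proof -
    from tangent_bundleD(2)[OF v] obtain c where c: "c \<in> A" "fst v \<in> fst c"
      by (auto simp: manifold_carrier_def)
    then have "tangent_chart A c \<in> charts_at (tangent_atlas A) v"
      using v by (auto simp: charts_at_def tangent_atlas_def tangent_chart_def)
    then show ?thesis
      unfolding Z_field_eq[OF c v] by (rule tangent.coord_vec_in_tangent_space)
  qed
  then have "Z_field A \<omega> \<in> (\<Pi>\<^sub>E v\<in>tangent_bundle A. tangent_space (tangent_atlas A) v)"
    by (auto simp: Z_field_def)
  moreover have "smooth_on (snd (tangent_chart A c) ` fst (tangent_chart A c))
      (\<lambda>y. snd (Z_field A \<omega> (chart_inv (tangent_chart A c) y)) (tangent_chart A c))"
    if c: "c \<in> A" for c
  proof -
    let ?U = "snd c ` fst c"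
    \<comment> \<open>Smoothness of the local form is known for fixed directions, so its argument is
      expanded in the standard basis. The sign is written as a scalar factor to fit the rule for
      bilinear maps.\<close>
    let ?f = "\<lambda>z. (snd z, - (1::real) *\<^sub>R ((\<Sum>j\<in>UNIV. snd z $ j *\<^sub>R
      local_form c (chart_inv c (fst z)) (axis j 1)) *v snd z))"
    have U: "open ?U" by (rule open_chart_image[OF c])
    then have o: "open (?U \<times> (UNIV :: (real^'n) set))" by (simp add: open_Times)
    have nth: "smooth_on (?U \<times> UNIV) (\<lambda>z. (snd z :: real^'n) $ j)" for j
      by (rule smooth_on_linear[OF bounded_linear_compose[OF bounded_linear_vec_nth bounded_linear_snd] o])
    have snd: "smooth_on (?U \<times> UNIV) (\<lambda>z. snd z :: real^'n)"
      by (rule smooth_on_linear[OF bounded_linear_snd o])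
    have "smooth_on (?U \<times> UNIV) ?f"
      by (intro smooth_on_Pair snd smooth_on_const
          bounded_bilinear.smooth_on[OF bounded_bilinear_scaleR]
          bounded_bilinear.smooth_on[OF bounded_bilinear_matrix_vector_mult]
          smooth_on_sum nth o smooth_on_fst[OF U smooth_on_local_form[OF c]])
    then have "smooth_on (?U \<times> UNIV)
      (\<lambda>y. snd (Z_field A \<omega> (chart_inv (tangent_chart A c) y)) (tangent_chart A c))"
    proof (rule smooth_on_cong[OF o, rotated])
      fix z :: "(real^'n) \<times> (real^'n)" assume z: "z \<in> ?U \<times> UNIV"
      let ?p = "chart_inv c (fst z)" and ?v = "coord_vec A c (chart_inv c (fst z)) (snd z)"
      from z have x: "fst z \<in> ?U" by auto
      have cp: "c \<in> charts_at A ?p" by (rule charts_at_chart_inv[OF c x])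
      have "chart_inv (tangent_chart A c) z = ?v"
        using chart_inv_tangent_chart[OF c x, of "snd z"] by simp
      moreover have "Z_field A \<omega> ?v = coord_vec (tangent_atlas A) (tangent_chart A c) ?v
          (snd z, - (local_form c ?p (snd z) *v snd z))"
        using Z_field_eq[OF c _ coord_vec_in_tangent_bundle[OF cp, of "snd z"]] charts_atD(2)[OF cp]
        by (simp add: fst_coord_vec coord_vec_same[OF cp])
      ultimately show "?f z = snd (Z_field A \<omega> (chart_inv (tangent_chart A c) z)) (tangent_chart A c)"
        by (simp add: tangent.coord_vec_same[OF tangent_chart_at[OF cp]]
            local_form_expansion[OF cp, of "snd z"])
    qed
    then show ?thesis using tangent_chart_image[OF c, of c] by simp
  qed
  then have "\<forall>c\<in>tangent_atlas A. smooth_on (snd c ` fst c) (\<lambda>y. snd (Z_field A \<omega> (chart_inv c y)) c)"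
    unfolding tangent_atlas_def by blast
  ultimately show ?thesis unfolding vector_fields_def carrier by blast
qed

text \<open>In the tangent charts the bundle projection is \<open>fst\<close>, hence so is its
  derivative, and the first component of \<open>Z_field\<close> at \<open>v\<close> is the
  coordinate vector of \<open>v\<close>.\<close>

lemma second_order_Z_field: "second_order_vector_field A (Z_field A \<omega>)"
proof -
  have "tangent_map (tangent_atlas A) A fst (Z_field A \<omega> v) = v" if v: "v \<in> tangent_bundle A" for v
  proof -
    from tangent_bundleD(2)[OF v] obtain c where c: "c \<in> A" "fst v \<in> fst c"
      by (auto simp: manifold_carrier_def)
    then have cp: "c \<in> charts_at A (fst v)" by (simp add: charts_at_def)
    note vT = tangent_bundleD(1)[OF v]
    have TC: "tangent_chart A c \<in> charts_at (tangent_atlas A) v"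
      using tangent_chart_at[OF cp, of "snd v c"] tangent_space_eq_coord_vec[OF vT cp] by simp
    let ?W = "snd c ` fst c \<times> (UNIV :: (real^'n) set)"
    have W: "open ?W" by (simp add: open_Times open_chart_image c)
    have vW: "snd (tangent_chart A c) v \<in> ?W" using c by (simp add: tangent_chart_def)
    have inv: "chart_inv (tangent_chart A c) y = coord_vec A c (chart_inv c (fst y)) (snd y)"
      if "y \<in> ?W" for y using chart_inv_tangent_chart[OF c(1), of "fst y" "snd y"] that by auto
    have "tangent_map (tangent_atlas A) A fst (Z_field A \<omega> v) =
        coord_vec A c (fst v) (fst (snd (Z_field A \<omega> v) (tangent_chart A c)))"
    proof (rule tangent_map_eq_coord_vec[where f = fst, OF C1_atlas_tangent_atlas C1_atlas_axioms TC cp _ W vW])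
      show "Z_field A \<omega> v \<in> tangent_space (tangent_atlas A) v"
        unfolding Z_field_eq[OF c v] by (rule tangent.coord_vec_in_tangent_space[OF TC])
      show "?W \<subseteq> snd (tangent_chart A c) ` fst (tangent_chart A c)"
        using tangent_chart_image[OF c(1), of c] by simp
      show "fst (chart_inv (tangent_chart A c) y) \<in> fst c" if "y \<in> ?W" for y
        unfolding inv[OF that] fst_coord_vec by (rule chart_inv_in) (use that in auto)
      show "((snd c \<circ> fst \<circ> chart_inv (tangent_chart A c)) has_derivative fst)
          (at (snd (tangent_chart A c) v))"
      proof (rule has_derivative_transform_within_open[OF _ W vW])
        show "(fst has_derivative fst) (at (snd (tangent_chart A c) v))"
          by (rule bounded_linear_imp_has_derivative[OF bounded_linear_fst])
        fix y assume y: "y \<in> ?W"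
        then have "fst y \<in> snd c ` fst c" by auto
        then show "fst y = (snd c \<circ> fst \<circ> chart_inv (tangent_chart A c)) y"
          by (simp add: inv[OF y] fst_coord_vec chart_chart_inv)
      qed
    qed
    also have "\<dots> = v"
      unfolding Z_field_eq[OF c v] tangent.coord_vec_same[OF TC]
      using tangent_space_eq_coord_vec[OF vT cp] by simp
    finally show ?thesis .
  qed
  with Z_field_in_vector_fields show ?thesis by (simp add: second_order_vector_field_def)
qed

section \<open>The local form and the Christoffel symbols\<close>

lemma frame_function_coord_vec:
  assumes c: "c \<in> charts_at A q" and m: "invertible m" and Y: "Y q = coord_vec A c q e"
  shows "frame_function Y (chart_frame A c q m) = matrix_inv m *v e"
proof -
  have "inj (chart_frame A c q m)"
    using chart_frame_in_frames_at[OF c m] by (simp add: frames_at_def bij_betw_def)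
  moreover have "chart_frame A c q m (matrix_inv m *v e) = Y q"
    by (simp add: chart_frame_def Y matrix_vector_mul_assoc matrix_inv_right[OF m])
  ultimately show ?thesis
    by (simp add: frame_function_def frame_proj_chart_frame inv_f_eq)
qed

text \<open>Near \<open>p\<close> the field has constant coordinates, so in the frame chart its
  frame function depends on the matrix alone and the base component of \<open>w\<close> contributes
  nothing. Agreement on a neighbourhood is enough, which is what makes global extensions
  usable.\<close>

lemma derivative_along_frame_function:
  assumes c: "c \<in> charts_at A p" and V: "openin (manifold_topology A) V" "p \<in> V" "V \<subseteq> fst c"
    and Y: "\<And>q. q \<in> V \<Longrightarrow> Y q = coord_vec A c q e"
    and w: "w \<in> tangent_space (frame_atlas A) (chart_frame A c p (mat 1))"
  shows "derivative_along (frame_atlas A) w (frame_function Y) = - (snd (snd w (frame_chart A c)) *v e)"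
proof (rule frame.derivative_along_eq[OF frame_chart_at[OF c invertible_one] w])
  let ?W = "snd c ` (fst c \<inter> V) \<times> {m :: real^'n^'n. invertible m}"
  have cA: "c \<in> A" using c by (rule charts_atD)
  show "((frame_function Y \<circ> chart_inv (frame_chart A c)) has_derivative (\<lambda>z. - (snd z *v e)))
      (at (snd (frame_chart A c) (chart_frame A c p (mat 1))))"
    unfolding frame_chart_chart_frame[OF c]
  proof (rule has_derivative_transform_within_open)
    show "((\<lambda>z. matrix_inv (snd z) *v e) has_derivative (\<lambda>z. - (snd z *v e))) (at (snd c p, mat 1))"
      using diff_chain_at[OF bounded_linear_imp_has_derivative[OF bounded_linear_snd],
          of "\<lambda>m. matrix_inv m *v e" _ "(snd c p, mat 1)"] has_derivative_matrix_inv_mult_vec[of e]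
      by (simp add: o_def)
    show "open ?W"
      by (intro open_Times open_invertible open_chart_image_openin[OF cA V(1)])
    show "(snd c p, mat 1) \<in> ?W" using charts_atD(2)[OF c] V(2) by (simp add: invertible_one)
    fix z assume "z \<in> ?W"
    then obtain q m where q: "z = (snd c q, m)" "q \<in> fst c" "q \<in> V" "invertible m" by auto
    then have "chart_inv (frame_chart A c) z = chart_frame A c q m"
      using chart_inv_frame_chart[OF cA, of "snd c q" m] by (simp add: chart_inv_chart[OF cA])
    moreover have "c \<in> charts_at A q" using q cA by (simp add: charts_at_def)
    ultimately show "matrix_inv (snd z) *v e = (frame_function Y \<circ> chart_inv (frame_chart A c)) z"
      using frame_function_coord_vec[of c q m Y e] q Y by simp
  qed
qed

text \<open>The description in \<open>local_nabla\<close> needs one value common to all extensions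
  and the existence of an extension. The first comes from computing with arbitrary extensions, the
  second from bump functions on the intersection of two neighbourhoods.\<close>

lemma christoffel_eq_local_form:
  assumes corr: "corresponding_connections A nabla \<omega>" and c: "c \<in> charts_at A p"
  shows "christoffel A nabla c p i j k = local_form c p (axis j 1) $ i $ k"
proof -
  have cA: "c \<in> A" "p \<in> fst c" using c by (auto dest: charts_atD)
  let ?u = "chart_frame A c p (mat 1)"
  let ?w = "coord_vec A c p (local_form c p (axis j 1) *v axis k 1)"
  have nabla: "nabla X' Y' p = ?w"
    if X': "X' \<in> vector_fields A" and Y': "Y' \<in> vector_fields A"
      and V: "openin (manifold_topology A) V" "p \<in> V" "V \<subseteq> fst c"
      and eq: "\<And>q. q \<in> V \<Longrightarrow> X' q = coord_field A c j q \<and> Y' q = coord_field A c k q" for X' Y' V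
  proof -
    have "nabla X' Y' p = ?u (derivative_along (frame_atlas A) (horizontal_lift A \<omega> X' ?u) (frame_function Y'))"
      using corr X' Y' frame_in_bundle[OF c invertible_one]
      unfolding corresponding_connections_def by (metis frame_proj_chart_frame)
    also have "horizontal_lift A \<omega> X' ?u =
        frame_vec c p (mat 1) (axis j 1, - local_form c p (axis j 1))"
      using eq[OF V(2)] horizontal_vector_eq[OF c invertible_one coord_vec_in_tangent_space[OF c]]
      by (simp add: horizontal_lift_def frame_proj_chart_frame coord_field_def coord_vec_same[OF c])
    \<comment> \<open>Two signs cancel here: one from the matrix part of the horizontal lift, one
      from differentiating the matrix inverse.\<close>
    also have "derivative_along (frame_atlas A) \<dots> (frame_function Y') =
        - (- local_form c p (axis j 1) *v axis k 1)"
      using derivative_along_frame_function[OF c V _ frame_vec_in[OF c invertible_one],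
          of Y' "axis k 1" "(axis j 1, - local_form c p (axis j 1))"] eq
      by (simp add: coord_field_def frame.coord_vec_same[OF frame_chart_at[OF c invertible_one]])
    finally show ?thesis
      by (simp add: chart_frame_def bounded_bilinear.minus_left[OF bounded_bilinear_matrix_vector_mult])
  qed
  obtain X V where X: "X \<in> vector_fields A" "openin (manifold_topology A) V" "p \<in> V" "V \<subseteq> fst c"
    "\<And>q. q \<in> V \<Longrightarrow> X q = coord_vec A c q (axis j 1)"
    using coord_vec_extension[OF cA] by metis
  obtain Y V' where Y: "Y \<in> vector_fields A" "openin (manifold_topology A) V'" "p \<in> V'" "V' \<subseteq> fst c"
    "\<And>q. q \<in> V' \<Longrightarrow> Y q = coord_vec A c q (axis k 1)"
    using coord_vec_extension[OF cA] by metis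
  have near: "openin (manifold_topology A) (V \<inter> V')" "p \<in> V \<inter> V'" "V \<inter> V' \<subseteq> fst c"
    "\<And>q. q \<in> V \<inter> V' \<Longrightarrow> X q = coord_field A c j q \<and> Y q = coord_field A c k q"
    using X Y by (auto simp: coord_field_def openin_Int)
  have "local_nabla A nabla (fst c) (coord_field A c j) (coord_field A c k) p = ?w"
    unfolding local_nabla_def
  proof (rule the_equality)
    have "?w = nabla X Y p" using nabla[OF X(1) Y(1) near] by simp
    with near X(1) Y(1) show "\<exists>X'\<in>vector_fields A. \<exists>Y'\<in>vector_fields A.
        (\<exists>V. openin (manifold_topology A) V \<and> p \<in> V \<and> V \<subseteq> fst c \<and>
          (\<forall>q\<in>V. X' q = coord_field A c j q \<and> Y' q = coord_field A c k q)) \<and> ?w = nabla X' Y' p"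
      by blast
  qed (use nabla in blast)
  \<comment> \<open>Multiplying by the \<open>k\<close>-th unit vector selects column
    \<open>k\<close>: the upper index is the row, the differentiated field gives the column.\<close>
  moreover have "(local_form c p (axis j 1) *v axis k 1) $ i = local_form c p (axis j 1) $ i $ k"
    by (simp add: matrix_vector_mul_component inner_axis)
  ultimately show ?thesis by (simp add: christoffel_def coord_vec_same[OF c])
qed

text \<open>The sum over \<open>j\<close> expands the direction argument of the local form, the sum
  over \<open>k\<close> is the matrix-vector product.\<close>

lemma christoffel_sum:
  assumes "corresponding_connections A nabla \<omega>" and c: "c \<in> charts_at A p"
  shows "(\<Sum>j\<in>UNIV. \<Sum>k\<in>UNIV. christoffel A nabla c p i j k * v $ j * v $ k) =
    (local_form c p v *v v) $ i"
proof -
  have "(local_form c p v *v v) $ i =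
      (\<Sum>k\<in>UNIV. \<Sum>j\<in>UNIV. v $ j * local_form c p (axis j 1) $ i $ k * v $ k)"
    by (subst local_form_expansion[OF c])
      (simp add: matrix_vector_mult_def sum_distrib_right)
  also have "\<dots> = (\<Sum>j\<in>UNIV. \<Sum>k\<in>UNIV. v $ j * local_form c p (axis j 1) $ i $ k * v $ k)"
    by (rule sum.swap)
  finally show ?thesis
    by (simp add: christoffel_eq_local_form[OF assms] mult_ac)
qed

end

theorem proposition3p1:
  fixes A :: "('m, real^'n) atlas"
    and nabla :: "('m \<Rightarrow> ('m, real^'n) tvec) \<Rightarrow> ('m \<Rightarrow> ('m, real^'n) tvec) \<Rightarrow> 'm \<Rightarrow> ('m, real^'n) tvec"
    and \<omega> :: "('m, 'n) frame_tvec \<Rightarrow> real^'n^'n"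
  assumes "smooth_manifold A"
    and "affine_connection A nabla"
    and "linear_connection A \<omega>"
    and "corresponding_connections A nabla \<omega>"
  shows "(\<forall>v\<in>tangent_bundle A. \<exists>!w. is_Z_value A \<omega> v w) \<and>
    second_order_vector_field A (Z_field A \<omega>) \<and>
    (\<forall>c\<in>A. \<forall>v\<in>tangent_bundle A. fst v \<in> fst c \<longrightarrow>
       Z_field A \<omega> v =
         coord_vec (tangent_atlas A) (tangent_chart A c) v
           (snd v c,
            \<chi> i. - (\<Sum>j\<in>UNIV. \<Sum>k\<in>UNIV.
                     christoffel A nabla c (fst v) i j k * snd v c $ j * snd v c $ k)))"
proof -
  interpret connection_form A \<omega>
    by unfold_locales (use assms in auto)
  have "\<exists>!w. is_Z_value A \<omega> v w" if v: "v \<in> tangent_bundle A" for v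
  proof -
    from tangent_bundleD(2)[OF v] obtain c where "c \<in> A" "fst v \<in> fst c"
      by (auto simp: manifold_carrier_def)
    from is_Z_value_iff[OF this v] show ?thesis by simp
  qed
  moreover have "Z_field A \<omega> v = coord_vec (tangent_atlas A) (tangent_chart A c) v
      (snd v c, \<chi> i. - (\<Sum>j\<in>UNIV. \<Sum>k\<in>UNIV.
        christoffel A nabla c (fst v) i j k * snd v c $ j * snd v c $ k))"
    if v: "c \<in> A" "v \<in> tangent_bundle A" "fst v \<in> fst c" for c v
  proof -
    have c: "c \<in> charts_at A (fst v)" using v by (simp add: charts_at_def)
    have "(\<chi> i. - (\<Sum>j\<in>UNIV. \<Sum>k\<in>UNIV.
        christoffel A nabla c (fst v) i j k * snd v c $ j * snd v c $ k)) =
        - (local_form c (fst v) (snd v c) *v snd v c)"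
      by (simp add: vec_eq_iff christoffel_sum[OF assms(4) c])
    then show ?thesis using Z_field_eq[OF v(1,3,2)] by simp
  qed
  ultimately show ?thesis using second_order_Z_field by blast
qed

end
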